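(* Let $(X,d)$ be a complete metric space and $S=\{S(t,s)\colon t\geqslant s,\ t,s\in\mathbb{R}\}$ be a continuous evolution process in $X$ such that there exists a closed, uniformly bounded, and positively invariant uniformly pullback absorbing family $\hat{B}=\{B_t\}_{t\in\mathbb{R}}$ for $S$. Suppose that there exists $\gamma>0$ such that for each $s\in\mathbb{R}$ and $0\leqslant\tau\leqslant\gamma$ there exists a constant $L_{\tau,s}>0$ such that \[ d(S(s+\tau,s)x,S(s+\tau,s)y)\leqslant L_{\tau,s}\,d(x,y)\quad\text{for all } x,y\in B_s. \] Assume also that there exist $\beta\in(0,1)$, $r>0$, $T>0$, $C>0$ satisfying: given $t\in\mathbb{R}$, there exist a positive integer $m$, functions $g_1,g_2\colon(\mathbb{R}^+)^m\to\mathbb{R}^+$, $\psi_1,\psi_2\colon X\times X\to\mathbb{R}^+$ and pseudometrics $\rho_1,\ldots,\rho_m$ on $X$ such that: (i) for $i=1,2$, $g_i$ is non-decreasing with respect to each variable, $g_i(0,\ldots,0)=0$, and $g_i$ is continuous at $(0,\ldots,0)$; (ii) for each $n\in\mathbb{N}$, $\rho_1,\ldots,\rho_m$ are precompact on $B_{t-nT}$; (iii) $\psi_1,\psi_2\in\operatorname{contr}(B_{t-nT})$ for all $n\in\mathbb{N}$; (iv) for each $n\in\mathbb{N}$ and all $x,y\in B_{t-nT}$, with $S_n:=S(t-(n-1)T,t-nT)$, we have \[ d(S_nx,S_ny)^r\leqslant d(x,y)^r+g_1(\rho_1(x,y),\ldots,\rho_m(x,y))+\psi_1(x,y) \] and \[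 d(S_nx,S_ny)^r\leqslant C\big[d(x,y)^r-d(S_nx,S_ny)^r+g_1(\rho_1(x,y),\ldots,\rho_m(x,y))+\psi_1(x,y)\big]^\beta+g_2(\rho_1(x,y),\ldots,\rho_m(x,y))+\psi_2(x,y). \] Then $S$ is $\varphi$-pullback $\kappa$-dissipative, with the decay function $\varphi$ given by $\varphi(s)=s^{\frac{\beta}{r(\beta-1)}}$. Also, $S$ has a uniformly bounded generalized $\varphi$-pullback attractor $\hat{M}$.
   Context: $\mathbb{R}^+=[0,\infty)$ and $\mathbb{N}=\{0,1,2,\ldots\}$. A continuous evolution process in $X$ is a family $S=\{S(t,s)\colon t\geqslant s,\ t,s\in\mathbb{R}\}$ of continuous maps $X\to X$ with $S(t,t)x=x$ for all $x\in X$, $t\in\mathbb{R}$; $S(t,r)S(r,s)=S(t,s)$ for $t\geqslant r\geqslant s$; and $(t,s,x)\mapsto S(t,s)x$ continuous. A family $\hat{D}=\{D_t\}_{t\in\mathbb{R}}$ consists of nonempty subsets $D_t\subset X$; it is closed (compact) if each $D_t$ is closed (compact), and uniformly bounded if $\bigcup_{t\in\mathbb{R}}D_t$ is a bounded subset of $X$. $\hat{B}$ is positively invariant for $S$ if $S(t,s)B_s\subset B_t$ for all $t\geqslant s$. $\hat{B}$ is uniformly pullback absorbing if given $D\subset X$ bounded and $t\in\mathbb{R}$ there exists $T>0$ such that $S(s,s-r)D\subset B_s$ for all $s\leqslant t$ and $r\geqslant T$. For $B\subset X$, a function $\psi\colon X\times X\to\mathbb{R}^+$ is contractive on $B$, written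 $\psi\in\operatorname{contr}(B)$, if $\liminf_{m,n\to\infty}\psi(x_n,x_m)=0$ for each sequence $\{x_n\}\subset B$; equivalently (as stated in the paper), each sequence $\{x_n\}\subset B$ has a subsequence $\{x_{n_k}\}$ with $\lim_{k,\ell\to\infty}\psi(x_{n_k},x_{n_\ell})=0$. A pseudometric on $X$ is a function $\rho\colon X\times X\to[0,\infty)$ with $\rho(x,x)=0$, $\rho(x,y)=\rho(y,x)$ and $\rho(x,z)\leqslant\rho(x,y)+\rho(y,z)$. A pseudometric $\rho$ is precompact on a nonempty $B\subset X$ if for every $\delta>0$ there is a finite set $\{x_1,\ldots,x_q\}\subset B$ with $B\subset\bigcup_{j=1}^q\{y\in X\colon\rho(y,x_j)<\delta\}$. A decay function is a decreasing function $\varphi\colon[k,\infty)\to[0,\infty)$, for some constant $k\geqslant 0$, with $\lim_{t\to\infty}\varphi(t)=0$ and $\limsup_{t\to\infty}\frac{\varphi(\omega t+\eta)}{\varphi(\omega t)}<\infty$ for every $\omega>0$ and $\eta\in\mathbb{R}$. (The power $\varphi(s)=s^{\beta/(r(\beta-1))}$ has negative exponent and is regarded as defined on some $[k,\infty)$ with $k>0$.) The Kuratowski measure of non-compactness of a bounded set $B\subset X$ is $\kappa(B)=\inf\{\delta>0\colon B$ admits a finite cover by sets of diameter $\leqslant\delta\}$. $S$ is $\varphi$-pullback $\kappa$-dissipative if there exists $\omega>0$ such that for every bounded $D\subset X$ and $t\in\mathbb{R}$ there exist $C\geqslant0$ and $\tau_0\geqslant 0$ with $\kappa\big(\bigcup_{\sigma\geqslant\tau}S(t,t-\sigma)D\big)\leqslant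 C\varphi(\omega\tau)$ for all $\tau\geqslant\tau_0$. The Hausdorff semidistance is $d_H(U,V)=\sup_{u\in U}\inf_{v\in V}d(u,v)$. A family $\hat{M}$ is a generalized $\varphi$-pullback attractor for $S$ if it is compact, positively invariant, and there exists $\omega>0$ such that for every bounded $D\subset X$ and $t\in\mathbb{R}$ there exist $C=C(D,t)\geqslant0$, $\tau_0=\tau_0(D,t)\geqslant0$ with $d_H(S(t,t-\tau)D,M_t)\leqslant C\varphi(\omega\tau)$ for all $\tau\geqslant\tau_0$. *)

theory Defs
  imports "HOL-Analysis.Analysis"
begin

text \<open>
  The phase space is a type of class \<^class>\<open>metric_space\<close>. A two-parameter family of maps
  is a total function \<open>S :: real \<Rightarrow> real \<Rightarrow> 'a \<Rightarrow> 'a\<close>, and only its values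
  \<open>S t s\<close> with \<open>s \<le> t\<close> are ever used.
\<close>

definition evolution_process :: "(real \<Rightarrow> real \<Rightarrow> 'a \<Rightarrow> 'a :: metric_space) \<Rightarrow> bool" where
  "evolution_process S \<longleftrightarrow>
     (\<forall>t s. s \<le> t \<longrightarrow> continuous_on UNIV (S t s)) \<and>
     (\<forall>t x. S t t x = x) \<and>
     (\<forall>t r s x. s \<le> r \<longrightarrow> r \<le> t \<longrightarrow> S t r (S r s x) = S t s x) \<and>
     continuous_on {(t, s, x). s \<le> t} (\<lambda>(t, s, x). S t s x)"

definition set_family :: "(real \<Rightarrow> 'a set) \<Rightarrow> bool" where
  "set_family B \<longleftrightarrow> (\<forall>t. B t \<noteq> {})"

definition closed_family :: "(real \<Rightarrow> 'a :: metric_space set) \<Rightarrow> bool" where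
  "closed_family B \<longleftrightarrow> (\<forall>t. closed (B t))"

definition compact_family :: "(real \<Rightarrow> 'a :: metric_space set) \<Rightarrow> bool" where
  "compact_family B \<longleftrightarrow> (\<forall>t. compact (B t))"

definition uniformly_bounded :: "(real \<Rightarrow> 'a :: metric_space set) \<Rightarrow> bool" where
  "uniformly_bounded B \<longleftrightarrow> bounded (\<Union>t. B t)"

definition positively_invariant ::
  "(real \<Rightarrow> real \<Rightarrow> 'a \<Rightarrow> 'a) \<Rightarrow> (real \<Rightarrow> 'a set) \<Rightarrow> bool" where
  "positively_invariant S B \<longleftrightarrow> (\<forall>t s. s \<le> t \<longrightarrow> S t s ` B s \<subseteq> B t)"

definition uniformly_pullback_absorbing ::
  "(real \<Rightarrow> real \<Rightarrow> 'a \<Rightarrow> 'a :: metric_space) \<Rightarrow> (real \<Rightarrow> 'a set) \<Rightarrow> bool" where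
  "uniformly_pullback_absorbing S B \<longleftrightarrow>
     (\<forall>D t. bounded D \<longrightarrow> (\<exists>T>0. \<forall>s\<le>t. \<forall>r\<ge>T. S s (s - r) ` D \<subseteq> B s))"

text \<open>
  The condition that \<open>lim inf \<psi> (x\<^sub>n, x\<^sub>m) = 0\<close> as \<open>m, n \<rightarrow> \<infinity>\<close> for every sequence in \<open>B\<close>,
  in its subsequence form. The double limit inferior must not be read as a limit inferior along
  the product filter: through the diagonal \<open>m = n\<close> that one is \<open>0\<close> for every \<open>\<psi>\<close> with
  \<open>\<psi> x x = 0\<close>.
\<close>
definition contr :: "'a set \<Rightarrow> ('a \<Rightarrow> 'a \<Rightarrow> real) set" where
  "contr B = {\<psi>. \<forall>x :: nat \<Rightarrow> 'a. (\<forall>n. x n \<in> B) \<longrightarrow>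
     (\<exists>\<sigma> :: nat \<Rightarrow> nat. strict_mono \<sigma> \<and>
        ((\<lambda>(k, l). \<psi> (x (\<sigma> k)) (x (\<sigma> l))) \<longlongrightarrow> 0) (sequentially \<times>\<^sub>F sequentially))}"

definition pseudometric :: "('a \<Rightarrow> 'a \<Rightarrow> real) \<Rightarrow> bool" where
  "pseudometric \<rho> \<longleftrightarrow>
     (\<forall>x y. 0 \<le> \<rho> x y) \<and> (\<forall>x. \<rho> x x = 0) \<and> (\<forall>x y. \<rho> x y = \<rho> y x) \<and>
     (\<forall>x y z. \<rho> x z \<le> \<rho> x y + \<rho> y z)"

definition precompact_on :: "('a \<Rightarrow> 'a \<Rightarrow> real) \<Rightarrow> 'a set \<Rightarrow> bool" where
  "precompact_on \<rho> B \<longleftrightarrow>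
     (\<forall>\<delta>>0. \<exists>F. finite F \<and> F \<subseteq> B \<and> B \<subseteq> (\<Union>x\<in>F. {y. \<rho> y x < \<delta>}))"

text \<open>
  \<open>[0, \<infinity>)\<^sup>m\<close> is the set of sequences with nonnegative entries that vanish from index \<open>m\<close> on
  (coordinates are numbered from \<open>0\<close>); the product topology of \<^typ>\<open>nat \<Rightarrow> real\<close> induces the
  Euclidean topology on it.
\<close>
definition orthant :: "nat \<Rightarrow> (nat \<Rightarrow> real) set" where
  "orthant m = {u. (\<forall>i<m. 0 \<le> u i) \<and> (\<forall>i\<ge>m. u i = 0)}"

definition pseudometric_vec :: "nat \<Rightarrow> (nat \<Rightarrow> 'a \<Rightarrow> 'a \<Rightarrow> real) \<Rightarrow> 'a \<Rightarrow> 'a \<Rightarrow> nat \<Rightarrow> real" where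
  "pseudometric_vec m \<rho> x y = (\<lambda>i. if i < m then \<rho> i x y else 0)"

definition nondecreasing_in_each :: "nat \<Rightarrow> ((nat \<Rightarrow> real) \<Rightarrow> real) \<Rightarrow> bool" where
  "nondecreasing_in_each m g \<longleftrightarrow> (\<forall>u\<in>orthant m. \<forall>i<m. \<forall>a\<ge>u i. g u \<le> g (u(i := a)))"

text \<open>
  A decay function is given by a total function \<open>\<phi>\<close> together with the left end point \<open>k\<close> of its
  domain \<open>[k, \<infinity>)\<close>.
\<close>
definition decay_function :: "real \<Rightarrow> (real \<Rightarrow> real) \<Rightarrow> bool" where
  "decay_function k \<phi> \<longleftrightarrow>
     0 \<le> k \<and> (\<forall>s\<ge>k. 0 \<le> \<phi> s) \<and> antimono_on {k..} \<phi> \<and> (\<phi> \<longlongrightarrow> 0) at_top \<and>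
     (\<forall>\<omega>>0. \<forall>\<eta>. Limsup at_top (\<lambda>t. ereal (\<phi> (\<omega> * t + \<eta>) / \<phi> (\<omega> * t))) < \<infinity>)"

text \<open>
  With values in \<^typ>\<open>ennreal\<close>, an unbounded set has measure of non-compactness \<open>\<infinity>\<close>.
  Boundedness of the covering sets is required since \<^const>\<open>diameter\<close> is unspecified on
  unbounded sets.
\<close>
definition kuratowski :: "'a :: metric_space set \<Rightarrow> ennreal" where
  "kuratowski B = Inf {ennreal \<delta> | \<delta>. \<delta> > 0 \<and>
     (\<exists>\<U>. finite \<U> \<and> B \<subseteq> \<Union>\<U> \<and> (\<forall>U\<in>\<U>. bounded U \<and> diameter U \<le> \<delta>))}"

text \<open>
  The condition \<open>k \<le> \<omega> * \<tau>\<^sub>0\<close> here and below ensures that \<open>\<phi>\<close> is evaluated on its domain only.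
\<close>
definition pullback_kappa_dissipative ::
  "real \<Rightarrow> (real \<Rightarrow> real) \<Rightarrow> (real \<Rightarrow> real \<Rightarrow> 'a \<Rightarrow> 'a :: metric_space) \<Rightarrow> bool" where
  "pullback_kappa_dissipative k \<phi> S \<longleftrightarrow>
     (\<exists>\<omega>>0. \<forall>D t. bounded D \<longrightarrow>
        (\<exists>C\<ge>0. \<exists>\<tau>\<^sub>0\<ge>0. k \<le> \<omega> * \<tau>\<^sub>0 \<and>
           (\<forall>\<tau>\<ge>\<tau>\<^sub>0. kuratowski (\<Union>\<sigma>\<in>{\<tau>..}. S t (t - \<sigma>) ` D) \<le> ennreal (C * \<phi> (\<omega> * \<tau>)))))"

definition hausdorff_semidist :: "'a :: metric_space set \<Rightarrow> 'a set \<Rightarrow> ennreal" where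
  "hausdorff_semidist U V = (SUP u\<in>U. INF v\<in>V. ennreal (dist u v))"

definition generalized_pullback_attractor ::
  "real \<Rightarrow> (real \<Rightarrow> real) \<Rightarrow> (real \<Rightarrow> real \<Rightarrow> 'a \<Rightarrow> 'a :: metric_space) \<Rightarrow> (real \<Rightarrow> 'a set) \<Rightarrow> bool"
where
  "generalized_pullback_attractor k \<phi> S M \<longleftrightarrow>
     set_family M \<and> compact_family M \<and> positively_invariant S M \<and>
     (\<exists>\<omega>>0. \<forall>D t. bounded D \<longrightarrow>
        (\<exists>C\<ge>0. \<exists>\<tau>\<^sub>0\<ge>0. k \<le> \<omega> * \<tau>\<^sub>0 \<and>
           (\<forall>\<tau>\<ge>\<tau>\<^sub>0. hausdorff_semidist (S t (t - \<tau>) ` D) (M t) \<le> ennreal (C * \<phi> (\<omega> * \<tau>)))))"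

end

(*
  Along any sequence in B_s one can pick a pair of points for which the g and psi terms are
  negligible during n consecutive steps of length T. The r-th powers e_j of the distances after
  j steps then satisfy e_(j+1) <= K (e_j - e_(j+1))^beta up to a small error, which forces
  e_n <= c n^(-beta/(1-beta)) with c independent of s. Hence no sequence in S(s+nT, s) B_s is
  separated at scale c n^(-beta/(r(1-beta))), so this set has a finite net of that scale. This
  gives kappa-dissipativity. At times in the lattice T Z the attractor is the closure of the union
  of all such nets, transported forward by the process; at times in between it is the image of
  the preceding lattice set, and the Lipschitz condition preserves the rate.
*)
theory Submission
  imports Defs "HOL-Real_Asymp.Real_Asymp"
begin

text \<open>The exponent comes from the differential equation e' = -(e/K)^(1/\<beta>), whose
  solutions decay like t^(-\<beta>/(1-\<beta>)); taking r-th roots gives \<beta>/(r(\<beta>-1)). A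
  contractive \<psi> obeys no triangle inequality, so small error terms cannot be turned into covers
  step by step; the argument stays with subsequences through all n steps and extracts a cover only
  from the final distances. The tolerated error depends on n, whereas c depends only on \<beta>, C,
  r and the common bound on the sets B_s, so the functions and pseudometrics may vary with time.
  Transport along a lattice keeps the attractor countable up to closure: only finitely many nets
  reach a given time after fewer than N steps in total, which is what compactness uses. The
  Lipschitz condition enters only between the last lattice time and t, so its constant may depend on
  t.\<close>

section \<open>Decay of sequences under a power recursion\<close>

text \<open>The recursion forces a drop a - b of at least (b/K)^(1/\<beta>), and the derivative of
  x^(-\<theta>) is -\<theta> x^(-1/\<beta>); so x^(-\<theta>) grows by a fixed amount per step. The
  mean value theorem gives this while a and b are comparable. If a > 2b, the drop is so large that
  comparing the values at a/2 and a is enough; there the bound M enters.\<close>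

lemma powr_recursion_step:
  fixes a b K M \<beta> :: real
  assumes "0 < \<beta>" "\<beta> < 1" "0 < K" "0 < b" "b \<le> a" "a \<le> M" "b \<le> K * (a - b) powr \<beta>"
  defines "\<theta> \<equiv> 1 / \<beta> - 1"
  shows "a powr (- \<theta>) + min (\<theta> * (2 * K) powr (- (1 / \<beta>))) ((2 powr \<theta> - 1) * M powr (- \<theta>))
    \<le> b powr (- \<theta>)"
proof -
  have \<theta>: "0 < \<theta>" using assms by (simp add: field_simps)
  have exponent: "- \<theta> - 1 = - (1 / \<beta>)" by (simp add: \<theta>_def)
  have "(b / K) powr (1 / \<beta>) \<le> ((a - b) powr \<beta>) powr (1 / \<beta>)"
    using assms by (intro powr_mono2) (auto simp: field_simps)
  also have "\<dots> = a - b" using assms by (simp add: powr_powr)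
  finally have gap: "(b / K) powr (1 / \<beta>) \<le> a - b" .
  have "0 < (b / K) powr (1 / \<beta>)" using assms by simp
  with gap have "b < a" by linarith
  show ?thesis
  proof (cases "a \<le> 2 * b")
    case True
    have "\<exists>z. b < z \<and> z < a \<and>
        a powr (- \<theta>) - b powr (- \<theta>) = (a - b) * (- \<theta> * z powr (- \<theta> - 1))"
      using \<open>b < a\<close> \<open>0 < b\<close>
      by (intro MVT2) (auto intro!: DERIV_cong[OF has_real_derivative_powr])
    then obtain z where z: "b < z" "z < a"
      "a powr (- \<theta>) - b powr (- \<theta>) = (a - b) * (- \<theta> * z powr (- \<theta> - 1))" by blast
    \<comment> \<open>The powers of b cancel, so the increment depends on K and \<beta>
      alone.\<close>
    have "(2 * K) powr (- (1 / \<beta>)) = (b / K) powr (1 / \<beta>) * (2 * b) powr (- (1 / \<beta>))"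
      using assms by (simp add: powr_mult powr_divide powr_minus field_simps)
    also have "\<dots> \<le> (a - b) * z powr (- (1 / \<beta>))"
      using gap z True assms
      by (intro mult_mono powr_mono2') auto
    finally have "\<theta> * (2 * K) powr (- (1 / \<beta>)) \<le> \<theta> * ((a - b) * z powr (- (1 / \<beta>)))"
      using \<theta> by (intro mult_left_mono) auto
    also have "\<dots> = b powr (- \<theta>) - a powr (- \<theta>)"
      using z(3) exponent by (simp add: algebra_simps)
    finally show ?thesis by linarith
  next
    case False
    have "(2 powr \<theta> - 1) * M powr (- \<theta>) \<le> (2 powr \<theta> - 1) * a powr (- \<theta>)"
      using assms \<theta> by (intro mult_left_mono powr_mono2') (auto simp: ge_one_powr_ge_zero)
    also have "\<dots> = (a / 2) powr (- \<theta>) - a powr (- \<theta>)"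
      using assms by (simp add: powr_divide powr_minus field_simps)
    also have "(a / 2) powr (- \<theta>) \<le> b powr (- \<theta>)"
      using False assms \<theta> by (intro powr_mono2') auto
    finally show ?thesis by linarith
  qed
qed

text \<open>Summing the fixed increments gives n * c0 <= e_n^(-\<theta>), which is then inverted.
  The constant is fixed before n and e are chosen.\<close>

lemma powr_recursion_decay:
  fixes \<beta> K M :: real
  assumes "0 < \<beta>" "\<beta> < 1" "0 < K" "0 < M"
  shows "\<exists>c>0. \<forall>n e. 0 < n \<longrightarrow> e 0 \<le> M \<longrightarrow> 0 < e n \<longrightarrow>
    (\<forall>j<n. e (Suc j) \<le> e j \<and> e (Suc j) \<le> K * (e j - e (Suc j)) powr \<beta>) \<longrightarrow>
    e n \<le> c * real n powr (- (\<beta> / (1 - \<beta>)))"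
proof -
  define \<theta> where "\<theta> = 1 / \<beta> - 1"
  define c0 where "c0 = min (\<theta> * (2 * K) powr (- (1 / \<beta>))) ((2 powr \<theta> - 1) * M powr (- \<theta>))"
  have \<theta>: "0 < \<theta>" using assms by (simp add: \<theta>_def field_simps)
  have inv\<theta>: "1 / \<theta> = \<beta> / (1 - \<beta>)" using assms by (simp add: \<theta>_def field_simps)
  have c0: "0 < c0" using assms \<theta> by (simp add: c0_def)
  have main: "e n \<le> c0 powr (- (1 / \<theta>)) * real n powr (- (1 / \<theta>))"
    if n: "0 < n" and M: "e 0 \<le> M" and pos: "0 < e n"
      and rec: "\<And>j. j < n \<Longrightarrow> e (Suc j) \<le> e j"
        "\<And>j. j < n \<Longrightarrow> e (Suc j) \<le> K * (e j - e (Suc j)) powr \<beta>"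
    for n and e :: "nat \<Rightarrow> real"
  proof -
    \<comment> \<open>By monotonicity, positivity of the last term passes to all earlier ones, as
      their negative powers require.\<close>
    have below: "e n \<le> e j" if "j \<le> n" for j
      using that by (induction rule: inc_induct) (use rec in force)+
    have above: "e j \<le> M" if "j \<le> n" for j
      using that
    proof (induction j)
      case (Suc j)
      then show ?case using rec(1)[of j] by simp
    qed (rule M)
    have "real j * c0 \<le> e j powr (- \<theta>)" if "j \<le> n" for j
      using that
    proof (induction j)
      case (Suc j)
      have "e j powr (- \<theta>) + c0 \<le> e (Suc j) powr (- \<theta>)"
        unfolding c0_def \<theta>_def
        using Suc.prems assms pos below[of "Suc j"] above[of j] rec[of j]
        by (intro powr_recursion_step) auto
      then show ?case using Suc by (simp add: algebra_simps)
    qed simp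
    then have "real n * c0 \<le> e n powr (- \<theta>)" by simp
    then have "(e n powr (- \<theta>)) powr (- (1 / \<theta>)) \<le> (real n * c0) powr (- (1 / \<theta>))"
      using n c0 \<theta> by (intro powr_mono2') auto
    then show ?thesis using \<theta> pos n c0 by (simp add: powr_powr powr_mult mult.commute)
  qed
  show ?thesis
  proof (intro exI[of _ "c0 powr (- (1 / \<theta>))"] conjI allI impI)
    show "0 < c0 powr (- (1 / \<theta>))" using c0 by simp
  qed (unfold inv\<theta>[symmetric], rule main; blast)
qed

text \<open>The error may be chosen after n, so that even n errors together stay below half of the
  bound to be proved; c is chosen before n.\<close>

lemma perturbed_powr_recursion_decay:
  fixes \<beta> C M :: real
  assumes "0 < \<beta>" "\<beta> < 1" "0 < C" "0 < M"
  shows "\<exists>c>0. \<forall>n>0. \<exists>\<epsilon>>0. \<forall>b. b 0 \<le> M \<longrightarrow> 0 \<le> b n \<longrightarrow>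
    (\<forall>j<n. b (Suc j) \<le> b j + \<epsilon> \<and> b (Suc j) \<le> C * (b j - b (Suc j) + \<epsilon>) powr \<beta> + \<epsilon>) \<longrightarrow>
    b n \<le> c * real n powr (- (\<beta> / (1 - \<beta>)))"
proof -
  obtain c where "c > 0" and c: "\<And>n e. 0 < n \<Longrightarrow> e 0 \<le> M + 1 \<Longrightarrow> 0 < e n \<Longrightarrow>
    (\<forall>j<n. e (Suc j) \<le> e j \<and> e (Suc j) \<le> (2 * C) * (e j - e (Suc j)) powr \<beta>) \<Longrightarrow>
    e n \<le> c * real n powr (- (\<beta> / (1 - \<beta>)))"
    using powr_recursion_decay[of \<beta> "2 * C" "M + 1"] assms by auto
  have "\<exists>\<epsilon>>0. \<forall>b. b 0 \<le> M \<longrightarrow> 0 \<le> b n \<longrightarrow>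
    (\<forall>j<n. b (Suc j) \<le> b j + \<epsilon> \<and> b (Suc j) \<le> C * (b j - b (Suc j) + \<epsilon>) powr \<beta> + \<epsilon>) \<longrightarrow>
    b n \<le> c * real n powr (- (\<beta> / (1 - \<beta>)))" if n: "0 < n" for n :: nat
  proof -
    define R where "R = c * real n powr (- (\<beta> / (1 - \<beta>)))"
    have "R > 0" using n \<open>c > 0\<close> by (simp add: R_def)
    \<comment> \<open>The total correction \<open>n * \<epsilon>\<close> is at most 1, so the
      corrected sequence starts below \<open>M + 1\<close>, and at most R/2, so it can be absorbed
      below.\<close>
    define \<epsilon> where "\<epsilon> = min 1 R / (2 * real n)"
    have \<epsilon>: "\<epsilon> > 0" "real n * \<epsilon> \<le> 1" "2 * real n * \<epsilon> \<le> R"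
      using \<open>R > 0\<close> n by (auto simp: \<epsilon>_def field_simps min_def)
    have "b n \<le> R"
      if b0: "b 0 \<le> M" and bn: "0 \<le> b n"
        and rec: "\<And>j. j < n \<Longrightarrow> b (Suc j) \<le> b j + \<epsilon>"
          "\<And>j. j < n \<Longrightarrow> b (Suc j) \<le> C * (b j - b (Suc j) + \<epsilon>) powr \<beta> + \<epsilon>" for b
    proof (rule ccontr)
      assume neg: "\<not> b n \<le> R"
      \<comment> \<open>the linear correction makes the perturbed sequence monotone\<close>
      define e where "e j = b j + (real n - real j) * \<epsilon>" for j
      have diff: "e j - e (Suc j) = b j - b (Suc j) + \<epsilon>" for j
        by (simp add: e_def algebra_simps)
      have dec: "e (Suc j) \<le> e j" if "j < n" for j using rec(1)[OF that] diff[of j] by linarith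
      have below: "e n \<le> e j" if "j \<le> n" for j
        using that by (induction rule: inc_induct) (use dec in force)+
      have en: "e n = b n" by (simp add: e_def)
      have "e (Suc j) \<le> (2 * C) * (e j - e (Suc j)) powr \<beta>" if "j < n" for j
      proof -
        have "e (Suc j) \<le> C * (e j - e (Suc j)) powr \<beta> + (\<epsilon> + (real n - real (Suc j)) * \<epsilon>)"
          using rec(2)[OF that] unfolding diff by (simp add: e_def)
        also have "\<epsilon> + (real n - real (Suc j)) * \<epsilon> \<le> real n * \<epsilon>"
          using \<epsilon>(1) by (simp add: algebra_simps)
        finally have "e (Suc j) \<le> C * (e j - e (Suc j)) powr \<beta> + real n * \<epsilon>" by simp
        \<comment> \<open>Under the contrary assumption all terms exceed R, so the error is at most
          half of the left side; moving it over turns C into 2C.\<close>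
        moreover have "2 * (real n * \<epsilon>) \<le> e (Suc j)"
          using below[of "Suc j"] that en neg \<epsilon>(3) by auto
        ultimately show ?thesis by (simp add: mult.assoc)
      qed
      then have "e n \<le> R" unfolding R_def
        using n b0 \<epsilon> dec en neg \<open>R > 0\<close> by (intro c) (auto simp: e_def)
      then show False using en neg by simp
    qed
    then show ?thesis using \<epsilon>(1) unfolding R_def by blast
  qed
  then show ?thesis using \<open>c > 0\<close> by blast
qed

section \<open>Relations achieved along subsequences\<close>

text \<open>Quantifying over all sequences in \<open>A\<close> allows a subsequence to be thinned
  again for the next relation, so finitely many relations can be achieved together. No symmetry or
  triangle inequality is asked of \<open>P\<close>.\<close>

definition subseq_pairwise :: "'a set \<Rightarrow> ('a \<Rightarrow> 'a \<Rightarrow> bool) \<Rightarrow> bool" where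
  "subseq_pairwise A P \<longleftrightarrow> (\<forall>x :: nat \<Rightarrow> 'a. (\<forall>n. x n \<in> A) \<longrightarrow>
     (\<exists>\<sigma> :: nat \<Rightarrow> nat. strict_mono \<sigma> \<and> (\<forall>k l. k < l \<longrightarrow> P (x (\<sigma> k)) (x (\<sigma> l)))))"

lemma subseq_pairwise_mono:
  assumes "subseq_pairwise A P" and "\<And>x y. x \<in> A \<Longrightarrow> y \<in> A \<Longrightarrow> P x y \<Longrightarrow> Q x y"
  shows "subseq_pairwise A Q"
  using assms unfolding subseq_pairwise_def by meson

lemma subseq_pairwise_conj:
  assumes "subseq_pairwise A P" "subseq_pairwise A Q"
  shows "subseq_pairwise A (\<lambda>x y. P x y \<and> Q x y)"
  unfolding subseq_pairwise_def
proof (intro allI impI)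
  fix x :: "nat \<Rightarrow> 'a" assume x: "\<forall>n. x n \<in> A"
  obtain \<sigma> :: "nat \<Rightarrow> nat" where \<sigma>: "strict_mono \<sigma>" "\<And>k l. k < l \<Longrightarrow> P (x (\<sigma> k)) (x (\<sigma> l))"
    using assms(1) x unfolding subseq_pairwise_def by blast
  have "\<forall>n. (x \<circ> \<sigma>) n \<in> A" using x by simp
  then obtain \<sigma>' :: "nat \<Rightarrow> nat"
    where \<sigma>': "strict_mono \<sigma>'" "\<And>k l. k < l \<Longrightarrow> Q ((x \<circ> \<sigma>) (\<sigma>' k)) ((x \<circ> \<sigma>) (\<sigma>' l))"
    using assms(2) unfolding subseq_pairwise_def by blast
  show "\<exists>\<sigma> :: nat \<Rightarrow> nat. strict_mono \<sigma> \<and>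
      (\<forall>k l. k < l \<longrightarrow> P (x (\<sigma> k)) (x (\<sigma> l)) \<and> Q (x (\<sigma> k)) (x (\<sigma> l)))"
    using \<sigma> \<sigma>' by (intro exI[of _ "\<sigma> \<circ> \<sigma>'"]) (auto simp: strict_mono_def)
qed

lemma subseq_pairwise_ball:
  assumes "finite I" "\<And>i. i \<in> I \<Longrightarrow> subseq_pairwise A (P i)"
  shows "subseq_pairwise A (\<lambda>x y. \<forall>i\<in>I. P i x y)"
  using assms
proof (induction I rule: finite_induct)
  case empty
  have "strict_mono (id :: nat \<Rightarrow> nat)" by (simp add: strict_mono_def)
  then show ?case unfolding subseq_pairwise_def by auto
next
  case (insert i I)
  then show ?case using subseq_pairwise_conj[of A "P i"] by simp
qed

text \<open>This transfers a condition on the states at a later time to the initial points, so that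
  the conditions of different steps concern the same pair.\<close>

lemma subseq_pairwise_vimage:
  assumes "subseq_pairwise A P" "f ` A' \<subseteq> A"
  shows "subseq_pairwise A' (\<lambda>x y. P (f x) (f y))"
  unfolding subseq_pairwise_def
proof (intro allI impI)
  fix x :: "nat \<Rightarrow> 'b" assume "\<forall>n. x n \<in> A'"
  then have "\<forall>n. (f \<circ> x) n \<in> A" using assms(2) by auto
  then show "\<exists>\<sigma> :: nat \<Rightarrow> nat. strict_mono \<sigma> \<and> (\<forall>k l. k < l \<longrightarrow> P (f (x (\<sigma> k))) (f (x (\<sigma> l))))"
    using assms(1)[unfolded subseq_pairwise_def, rule_format, of "f \<circ> x"] by simp
qed

lemma subseq_pairwise_image:
  assumes "subseq_pairwise A (\<lambda>x y. P (f x) (f y))"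
  shows "subseq_pairwise (f ` A) P"
  unfolding subseq_pairwise_def
proof (intro allI impI)
  fix z :: "nat \<Rightarrow> 'b" assume "\<forall>n. z n \<in> f ` A"
  then have "\<forall>n. \<exists>x. x \<in> A \<and> z n = f x" by auto
  then obtain x where x: "\<And>n. x n \<in> A" "\<And>n. z n = f (x n)" by metis
  then show "\<exists>\<sigma> :: nat \<Rightarrow> nat. strict_mono \<sigma> \<and> (\<forall>k l. k < l \<longrightarrow> P (z (\<sigma> k)) (z (\<sigma> l)))"
    using assms unfolding subseq_pairwise_def by simp
qed

lemma subseq_pairwise_contr:
  assumes "\<psi> \<in> contr A" "0 < \<epsilon>"
  shows "subseq_pairwise A (\<lambda>x y. \<psi> x y < \<epsilon>)"
  unfolding subseq_pairwise_def
proof (intro allI impI)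
  fix x :: "nat \<Rightarrow> 'a" assume "\<forall>n. x n \<in> A"
  then obtain \<sigma> :: "nat \<Rightarrow> nat" where \<sigma>: "strict_mono \<sigma>"
    "((\<lambda>(k, l). \<psi> (x (\<sigma> k)) (x (\<sigma> l))) \<longlongrightarrow> 0) (sequentially \<times>\<^sub>F sequentially)"
    using assms(1) unfolding contr_def by blast
  have "eventually (\<lambda>(k, l). \<psi> (x (\<sigma> k)) (x (\<sigma> l)) < \<epsilon>) (sequentially \<times>\<^sub>F sequentially)"
    using order_tendstoD(2)[OF \<sigma>(2) assms(2)] by (simp add: case_prod_unfold)
  then obtain N where N: "\<And>k l. N \<le> k \<Longrightarrow> N \<le> l \<Longrightarrow> \<psi> (x (\<sigma> k)) (x (\<sigma> l)) < \<epsilon>"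
    by (auto simp: eventually_prod_sequentially)
  show "\<exists>\<sigma> :: nat \<Rightarrow> nat. strict_mono \<sigma> \<and> (\<forall>k l. k < l \<longrightarrow> \<psi> (x (\<sigma> k)) (x (\<sigma> l)) < \<epsilon>)"
    using \<sigma>(1) N by (intro exI[of _ "\<lambda>k. \<sigma> (k + N)"]) (auto simp: strict_mono_def)
qed

text \<open>Infinitely many terms lie in one of the finitely many balls of radius \<delta>/2; those
  terms form the subsequence.\<close>

lemma subseq_pairwise_precompact:
  assumes "pseudometric \<rho>" "precompact_on \<rho> A" "0 < \<delta>"
  shows "subseq_pairwise A (\<lambda>x y. \<rho> x y < \<delta>)"
  unfolding subseq_pairwise_def
proof (intro allI impI)
  fix x :: "nat \<Rightarrow> 'a" assume x: "\<forall>n. x n \<in> A"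
  obtain F where F: "finite F" "A \<subseteq> (\<Union>z\<in>F. {y. \<rho> y z < \<delta> / 2})"
    using assms(2,3) unfolding precompact_on_def by (meson half_gt_zero)
  have "\<exists>z\<in>F. infinite {n \<in> UNIV. \<rho> (x n) z < \<delta> / 2}"
    using x F by (intro pigeonhole_infinite_rel) auto
  then obtain z where "infinite {n. \<rho> (x n) z < \<delta> / 2}" by auto
  then obtain \<sigma> :: "nat \<Rightarrow> nat" where \<sigma>: "strict_mono \<sigma>" "\<And>n. \<rho> (x (\<sigma> n)) z < \<delta> / 2"
    using infinite_enumerate by blast
  have "\<rho> (x (\<sigma> k)) (x (\<sigma> l)) < \<delta>" for k l
  proof -
    have "\<rho> (x (\<sigma> k)) (x (\<sigma> l)) \<le> \<rho> (x (\<sigma> k)) z + \<rho> z (x (\<sigma> l))"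
      "\<rho> z (x (\<sigma> l)) = \<rho> (x (\<sigma> l)) z"
      using assms(1) unfolding pseudometric_def by blast+
    then show ?thesis using \<sigma>(2)[of k] \<sigma>(2)[of l] by linarith
  qed
  then show "\<exists>\<sigma> :: nat \<Rightarrow> nat. strict_mono \<sigma> \<and> (\<forall>k l. k < l \<longrightarrow> \<rho> (x (\<sigma> k)) (x (\<sigma> l)) < \<delta>)"
    using \<sigma>(1) by blast
qed

text \<open>Without such a net, points can be chosen greedily, each farther than \<eta> from all its
  predecessors, and no pair of this sequence satisfies the relation.\<close>

lemma subseq_pairwise_dist_imp_finite_net:
  fixes A :: "'a :: metric_space set"
  assumes "subseq_pairwise A (\<lambda>x y. dist x y \<le> \<eta>)"
  shows "\<exists>F. finite F \<and> F \<subseteq> A \<and> A \<subseteq> (\<Union>x\<in>F. cball x \<eta>)"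
proof (rule ccontr)
  assume neg: "\<not> ?thesis"
  let ?Q = "\<lambda>x n z. z \<in> A \<and> (\<forall>m < (n::nat). \<not> dist (x m) z \<le> \<eta>)"
  have "\<exists>x. \<forall>n::nat. ?Q x n (x n)"
  proof (rule dependent_wellorder_choice)
    fix n x assume "\<And>y. y < n \<Longrightarrow> ?Q x y (x y)"
    then have "\<not> A \<subseteq> (\<Union>x\<in>x ` {0..<n}. cball x \<eta>)"
      using neg by (metis finite_atLeastLessThan finite_imageI imageE image_subset_iff
          atLeastLessThan_iff)
    then show "\<exists>z. ?Q x n z" by auto
  qed simp
  then obtain x where x: "\<And>n::nat. x n \<in> A" "\<And>n m. m < n \<Longrightarrow> \<not> dist (x m) (x n) \<le> \<eta>"
    by blast
  then obtain \<sigma> :: "nat \<Rightarrow> nat"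
    where "strict_mono \<sigma>" "\<And>k l. k < l \<Longrightarrow> dist (x (\<sigma> k)) (x (\<sigma> l)) \<le> \<eta>"
    using assms unfolding subseq_pairwise_def by blast
  then show False using x(2)[of "\<sigma> 0" "\<sigma> 1"] by (auto simp: strict_mono_def)
qed

section \<open>Smallness of the functions g near the origin\<close>

text \<open>Monotonicity is given in each variable separately, so the coordinates are raised to
  \<delta> one at a time.\<close>

lemma orthant_nondecreasing_bound:
  assumes g: "nondecreasing_in_each m g"
    and u: "u \<in> orthant m" "\<And>i. i < m \<Longrightarrow> u i \<le> \<delta>"
  shows "g u \<le> g (\<lambda>i. if i < m then \<delta> else 0)"
proof -
  have "g u \<le> g (\<lambda>i. if i < j then \<delta> else u i)" if "j \<le> m" for j
    using that
  proof (induction j)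
    case (Suc j)
    let ?v = "\<lambda>i. if i < j then \<delta> else u i"
    have "0 \<le> u i" "u i \<le> \<delta>" if "i < m" for i
      using u that unfolding orthant_def by auto
    \<comment> \<open>The sign of \<delta> is read off from coordinate j, which exists because j <
      m.\<close>
    moreover from this have "0 \<le> \<delta>" using Suc.prems by (meson Suc_le_eq order_trans)
    ultimately have "?v \<in> orthant m"
      using u(1) Suc.prems unfolding orthant_def by auto
    then have "g ?v \<le> g (?v(j := \<delta>))"
      using g Suc.prems u(2)[of j] unfolding nondecreasing_in_each_def by auto
    also have "?v(j := \<delta>) = (\<lambda>i. if i < Suc j then \<delta> else u i)" by (auto simp: fun_eq_iff)
    finally show ?case using Suc by simp
  qed simp
  from this[of m] have "g u \<le> g (\<lambda>i. if i < m then \<delta> else u i)" by simp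
  also have "(\<lambda>i. if i < m then \<delta> else u i) = (\<lambda>i. if i < m then \<delta> else 0)"
    using u(1) by (auto simp: orthant_def fun_eq_iff)
  finally show ?thesis .
qed

text \<open>On a cube, g is largest at the corner (\<delta>, ..., \<delta>), so continuity along the
  diagonal suffices.\<close>

lemma orthant_small:
  assumes g: "nondecreasing_in_each m g" "g (\<lambda>_. 0) = 0"
      "continuous (at (\<lambda>_. 0) within orthant m) g"
    and "0 < \<epsilon>"
  shows "\<exists>\<delta>>0. \<forall>u\<in>orthant m. (\<forall>i<m. u i < \<delta>) \<longrightarrow> g u < \<epsilon>"
proof -
  let ?h = "\<lambda>(\<delta> :: real) (i :: nat). if i < m then \<delta> else 0"
  have "continuous_on {0..} (\<lambda>\<delta>. ?h \<delta>)"
  proof (rule continuous_on_coordinatewise_then_product)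
    show "continuous_on {0..} (\<lambda>\<delta>. ?h \<delta> i)" for i by (cases "i < m") auto
  qed
  moreover have "?h ` {0..} \<subseteq> orthant m" by (auto simp: orthant_def)
  moreover have h0: "?h 0 = (\<lambda>_. 0)" by auto
  ultimately have "continuous (at 0 within {0..}) (\<lambda>\<delta>. g (?h \<delta>))"
    using g(3)
    by (intro continuous_within_compose2[of 0 "{0..}" ?h g])
      (auto simp: continuous_on_eq_continuous_within intro: continuous_within_subset)
  then have "eventually (\<lambda>\<delta>. g (?h \<delta>) < \<epsilon>) (at 0 within {0..})"
    using \<open>0 < \<epsilon>\<close> g(2) h0 unfolding continuous_within by (intro order_tendstoD) auto
  then obtain d where d: "d > 0" "\<And>\<delta>. 0 < \<delta> \<Longrightarrow> \<delta> < d \<Longrightarrow> g (?h \<delta>) < \<epsilon>"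
    unfolding eventually_at by (force simp: dist_real_def)
  show ?thesis
  proof (intro exI[of _ "d / 2"] conjI ballI impI)
    fix u assume "u \<in> orthant m" "\<forall>i<m. u i < d / 2"
    then have "g u \<le> g (?h (d / 2))"
      by (intro orthant_nondecreasing_bound[OF g(1)]) (auto simp: less_imp_le)
    also have "\<dots> < \<epsilon>" using d by simp
    finally show "g u < \<epsilon>" .
  qed (use d in simp)
qed

lemma subseq_pairwise_pseudometric_vec:
  assumes g: "nondecreasing_in_each m g" "g (\<lambda>_. 0) = 0"
      "continuous (at (\<lambda>_. 0) within orthant m) g"
    and \<rho>: "\<And>i. i < m \<Longrightarrow> pseudometric (\<rho> i)" "\<And>i. i < m \<Longrightarrow> precompact_on (\<rho> i) A"
    and "0 < \<epsilon>"
  shows "subseq_pairwise A (\<lambda>x y. g (pseudometric_vec m \<rho> x y) < \<epsilon>)"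
proof -
  obtain \<delta> where \<delta>: "\<delta> > 0" "\<And>u. u \<in> orthant m \<Longrightarrow> (\<forall>i<m. u i < \<delta>) \<Longrightarrow> g u < \<epsilon>"
    using orthant_small[OF g \<open>0 < \<epsilon>\<close>] by blast
  have "subseq_pairwise A (\<lambda>x y. \<forall>i\<in>{..<m}. \<rho> i x y < \<delta>)"
    using \<rho> \<delta>(1) by (intro subseq_pairwise_ball subseq_pairwise_precompact) auto
  then show ?thesis
  proof (rule subseq_pairwise_mono)
    fix x y assume "\<forall>i\<in>{..<m}. \<rho> i x y < \<delta>"
    then show "g (pseudometric_vec m \<rho> x y) < \<epsilon>"
      using \<rho>(1) by (intro \<delta>(2)) (auto simp: orthant_def pseudometric_vec_def pseudometric_def)
  qed
qed

section \<open>Kuratowski measure, semidistance and decay function\<close>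

lemma kuratowski_le:
  assumes "finite F" "A \<subseteq> (\<Union>x\<in>F. cball x \<eta>)" "0 < \<eta>"
  shows "kuratowski A \<le> ennreal (2 * \<eta>)"
  unfolding kuratowski_def
proof (rule Inf_lower, rule CollectI, intro exI conjI)
  show "finite ((\<lambda>x. cball x \<eta>) ` F)" using assms by simp
  show "\<forall>U\<in>(\<lambda>x. cball x \<eta>) ` F. bounded U \<and> diameter U \<le> 2 * \<eta>"
  proof safe
    fix x
    have "dist y z \<le> 2 * \<eta>" if "y \<in> cball x \<eta>" "z \<in> cball x \<eta>" for y z
      using that dist_triangle2[of y z x] by (simp add: dist_commute)
    then show "diameter (cball x \<eta>) \<le> 2 * \<eta>"
      using assms(3) unfolding diameter_def by (auto intro!: cSUP_least)
  qed simp
qed (use assms in auto)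

lemma hausdorff_semidist_le:
  assumes "\<And>u. u \<in> U \<Longrightarrow> \<exists>v\<in>V. dist u v \<le> \<eta>"
  shows "hausdorff_semidist U V \<le> ennreal \<eta>"
  unfolding hausdorff_semidist_def
proof (rule SUP_least)
  fix u assume "u \<in> U"
  then obtain v where "v \<in> V" "dist u v \<le> \<eta>" using assms by blast
  then show "(INF v\<in>V. ennreal (dist u v)) \<le> ennreal \<eta>"
    by (intro INF_lower2[of v]) (auto intro: ennreal_leI)
qed

text \<open>The end point 1 avoids the default value \<open>0 powr p = 0\<close>, at which
  monotonicity would fail. The quotient tends to 1 because (\<omega> t + \<eta>)/(\<omega> t)
  does.\<close>

lemma decay_function_powr:
  assumes "p < 0"
  shows "decay_function 1 (\<lambda>s. s powr p)"
proof -
  have "Limsup at_top (\<lambda>t. ereal ((\<omega> * t + \<eta>) powr p / (\<omega> * t) powr p)) < \<infinity>"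
    if "0 < \<omega>" for \<omega> \<eta> :: real
  proof -
    have "((\<lambda>t. (\<omega> * t + \<eta>) / (\<omega> * t)) \<longlongrightarrow> 1) at_top" using that by real_asymp
    then have "((\<lambda>t. ((\<omega> * t + \<eta>) / (\<omega> * t)) powr p) \<longlongrightarrow> 1 powr p) at_top"
      by (intro tendsto_intros) auto
    then have "((\<lambda>t. (\<omega> * t + \<eta>) powr p / (\<omega> * t) powr p) \<longlongrightarrow> 1) at_top"
      by (simp add: powr_divide)
    then have "((\<lambda>t. ereal ((\<omega> * t + \<eta>) powr p / (\<omega> * t) powr p)) \<longlongrightarrow> ereal 1) at_top"
      by (intro tendsto_intros)
    then have "Limsup at_top (\<lambda>t. ereal ((\<omega> * t + \<eta>) powr p / (\<omega> * t) powr p)) = ereal 1"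
      by (intro lim_imp_Limsup) auto
    then show ?thesis by simp
  qed
  moreover have "((\<lambda>s :: real. s powr p) \<longlongrightarrow> 0) at_top"
    using assms by (intro tendsto_neg_powr filterlim_ident)
  moreover have "antimono_on {1..} (\<lambda>s. s powr p)"
    using assms by (intro monotone_onI powr_mono2') auto
  ultimately show ?thesis unfolding decay_function_def by auto
qed

section \<open>Processes with an absorbing family and their finite nets\<close>

locale absorbed_process =
  fixes S :: "real \<Rightarrow> real \<Rightarrow> 'a \<Rightarrow> 'a :: complete_space" and B :: "real \<Rightarrow> 'a set"
  assumes process: "evolution_process S" and nonempty_B: "set_family B"
    and closed_B: "closed_family B" and bounded_B: "uniformly_bounded B"
    and invariant_B: "positively_invariant S B"
    and absorbing_B: "uniformly_pullback_absorbing S B"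
begin

lemma S_refl: "S t t x = x"
  using process by (simp add: evolution_process_def)

lemma S_comp: "s \<le> u \<Longrightarrow> u \<le> t \<Longrightarrow> S t u (S u s x) = S t s x"
  using process by (simp add: evolution_process_def)

lemma continuous_on_S: "s \<le> t \<Longrightarrow> continuous_on A (S t s)"
  using process continuous_on_subset unfolding evolution_process_def by blast

lemma image_subset: "s \<le> t \<Longrightarrow> S t s ` B s \<subseteq> B t"
  using invariant_B by (simp add: positively_invariant_def)

text \<open>Images of B shrink as the starting time recedes, so a net for N steps also covers the
  image after any larger number of steps.\<close>

lemma image_antimono:
  assumes "s \<le> u" "u \<le> t"
  shows "S t s ` B s \<subseteq> S t u ` B u"
proof
  fix x assume "x \<in> S t s ` B s"
  then obtain y where "y \<in> B s" "x = S t u (S u s y)" using S_comp[OF assms] by auto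
  then show "x \<in> S t u ` B u" using image_subset[OF assms(1)] by blast
qed

text \<open>The interval is cut into pieces of length at most \<gamma>; invariance keeps the
  intermediate points in B, and the constants multiply.\<close>

lemma lipschitz_extend:
  assumes "0 < \<gamma>" and "\<forall>s. \<forall>\<tau>\<in>{0..\<gamma>}. \<exists>L>0. \<forall>x\<in>B s. \<forall>y\<in>B s.
      dist (S (s + \<tau>) s x) (S (s + \<tau>) s y) \<le> L * dist x y"
    and "s \<le> t"
  shows "\<exists>L>0. \<forall>x\<in>B s. \<forall>y\<in>B s. dist (S t s x) (S t s y) \<le> L * dist x y"
proof -
  have *: "\<exists>L>0. \<forall>x\<in>B s. \<forall>y\<in>B s. dist (S t s x) (S t s y) \<le> L * dist x y"
    if "s \<le> t" "t - s \<le> real k * \<gamma>" for k s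
    using that
  proof (induction k arbitrary: s)
    case 0
    then have "t = s" by simp
    then show ?case by (intro exI[of _ 1]) (simp add: S_refl)
  next
    case (Suc k)
    \<comment> \<open>The minimum keeps the last, possibly shorter, piece from passing t.\<close>
    define u where "u = min t (s + \<gamma>)"
    have u: "s \<le> u" "u \<le> t" "t - u \<le> real k * \<gamma>" "u - s \<in> {0..\<gamma>}"
      using Suc.prems \<open>0 < \<gamma>\<close> by (auto simp: u_def min_def algebra_simps)
    obtain L1 where L1: "L1 > 0" "\<And>x y. x \<in> B s \<Longrightarrow> y \<in> B s \<Longrightarrow>
        dist (S u s x) (S u s y) \<le> L1 * dist x y"
      using assms(2)[rule_format, OF u(4), of s] by auto
    obtain L2 where L2: "L2 > 0" "\<And>x y. x \<in> B u \<Longrightarrow> y \<in> B u \<Longrightarrow>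
        dist (S t u x) (S t u y) \<le> L2 * dist x y"
      using Suc.IH[OF u(2,3)] by blast
    have "dist (S t s x) (S t s y) \<le> (L2 * L1) * dist x y" if "x \<in> B s" "y \<in> B s" for x y
    proof -
      have "dist (S t u (S u s x)) (S t u (S u s y)) \<le> L2 * dist (S u s x) (S u s y)"
        using image_subset[OF u(1)] that by (intro L2) auto
      also have "\<dots> \<le> L2 * (L1 * dist x y)"
        using L1(2)[OF that] L2(1) by (intro mult_left_mono) auto
      finally show ?thesis using S_comp[OF u(1,2)] by (simp add: mult.assoc)
    qed
    then show ?case using L1(1) L2(1) by (intro exI[of _ "L2 * L1"]) auto
  qed
  obtain k :: nat where "t - s \<le> real k * \<gamma>"
    using reals_Archimedean3[OF \<open>0 < \<gamma>\<close>] less_imp_le by blast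
  then show ?thesis using * assms(3) by blast
qed

text \<open>This converts elapsed time into whole steps started in B: orbits from D are absorbed at
  time t - nT and then follow n steps of length T.\<close>

lemma eventually_absorbed:
  assumes "bounded D" "0 < T"
  shows "\<exists>\<tau>\<^sub>0\<ge>1. \<forall>\<tau>\<ge>\<tau>\<^sub>0. \<exists>n>0. \<tau> / (2 * T) \<le> real n \<and>
    (\<forall>\<sigma>\<ge>\<tau>. S t (t - \<sigma>) ` D \<subseteq> S t (t - real n * T) ` B (t - real n * T))"
proof -
  obtain R where R: "R > 0" "\<And>s \<rho>. s \<le> t \<Longrightarrow> R \<le> \<rho> \<Longrightarrow> S s (s - \<rho>) ` D \<subseteq> B s"
    using absorbing_B assms(1) unfolding uniformly_pullback_absorbing_def by meson
  have "\<exists>n>0. \<tau> / (2 * T) \<le> real n \<and>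
      (\<forall>\<sigma>\<ge>\<tau>. S t (t - \<sigma>) ` D \<subseteq> S t (t - real n * T) ` B (t - real n * T))"
    if \<tau>: "max 1 (2 * (R + T)) \<le> \<tau>" for \<tau>
  proof -
    \<comment> \<open>This is the largest number of steps leaving at least R for absorption.
      Rounding loses less than T, so \<tau> >= 2(R + T) still gives n >= \<tau>/(2T).\<close>
    define n where "n = nat \<lfloor>(\<tau> - R) / T\<rfloor>"
    have "1 \<le> (\<tau> - R) / T" using \<tau> R(1) assms(2) by (simp add: field_simps)
    then have floor: "1 \<le> \<lfloor>(\<tau> - R) / T\<rfloor>" by linarith
    then have n: "0 < n" "real n = of_int \<lfloor>(\<tau> - R) / T\<rfloor>" by (simp_all add: n_def)
    have upper: "real n \<le> (\<tau> - R) / T" and "(\<tau> - R) / T - 1 \<le> real n"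
      unfolding n(2) by linarith+
    moreover have "\<tau> / (2 * T) \<le> (\<tau> - R) / T - 1"
      using \<tau> assms(2) by (simp add: field_simps)
    ultimately have lower: "\<tau> / (2 * T) \<le> real n" by linarith
    have nT: "real n * T \<le> \<tau> - R" using upper assms(2) by (simp add: field_simps)
    have "S t (t - \<sigma>) x \<in> S t (t - real n * T) ` B (t - real n * T)"
      if "\<tau> \<le> \<sigma>" "x \<in> D" for \<sigma> x
    proof -
      let ?s = "t - real n * T"
      have "0 \<le> real n * T" using assms(2) by simp
      \<comment> \<open>Uniform absorption is essential: R was chosen for t but is applied at the
        earlier time t - nT, which depends on n.\<close>
      then have "S ?s (?s - (\<sigma> - real n * T)) x \<in> B ?s"
        using R(2)[of ?s "\<sigma> - real n * T"] nT that by auto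
      then have "S ?s (t - \<sigma>) x \<in> B ?s" by simp
      moreover have "S t ?s (S ?s (t - \<sigma>) x) = S t (t - \<sigma>) x"
        using \<open>0 \<le> real n * T\<close> nT that R(1) by (intro S_comp) auto
      ultimately show ?thesis by force
    qed
    then show ?thesis using n(1) lower by (intro exI[of _ n]) auto
  qed
  then show ?thesis by (intro exI[of _ "max 1 (2 * (R + T))"]) auto
qed

text \<open>The relation \<open>step\<close> at each time s + jT is pulled back to the initial
  points in \<open>B s\<close>, so one pair satisfies all n inequalities and the scalar recursion
  applies to it. Uniform boundedness supplies one starting bound M for all s.\<close>

lemma finite_net_of_iterated_quasi_stability:
  assumes \<beta>: "0 < \<beta>" "\<beta> < 1" and "0 < r" "0 < T" "0 < C"
    and step: "\<And>s \<epsilon>. 0 < \<epsilon> \<Longrightarrow> subseq_pairwise (B s) (\<lambda>x y.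
      dist (S (s + T) s x) (S (s + T) s y) powr r \<le> dist x y powr r + \<epsilon> \<and>
      dist (S (s + T) s x) (S (s + T) s y) powr r \<le>
        C * (dist x y powr r - dist (S (s + T) s x) (S (s + T) s y) powr r + \<epsilon>) powr \<beta> + \<epsilon>)"
  shows "\<exists>c>0. \<forall>n>0. \<forall>s. \<exists>F. finite F \<and> F \<subseteq> S (s + real n * T) s ` B s \<and>
    S (s + real n * T) s ` B s \<subseteq> (\<Union>x\<in>F. cball x (c * real n powr (\<beta> / (r * (\<beta> - 1)))))"
proof -
  define p where "p = \<beta> / (r * (\<beta> - 1))"
  have p: "- (\<beta> / (1 - \<beta>)) * (1 / r) = p"
    using \<beta> \<open>0 < r\<close> by (simp add: p_def divide_simps) (simp add: algebra_simps)
  obtain b where b: "\<And>x y s. x \<in> B s \<Longrightarrow> y \<in> B s \<Longrightarrow> dist x y \<le> b"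
    using bounded_B unfolding uniformly_bounded_def bounded_two_points by blast
  \<comment> \<open>The maximum with 1 makes M positive, as the recursion lemma requires.\<close>
  define M where "M = max b 1 powr r"
  have "M > 0" by (simp add: M_def)
  have M: "dist x y powr r \<le> M" if "x \<in> B s" "y \<in> B s" for x y s
    unfolding M_def using b[OF that] \<open>0 < r\<close> by (intro powr_mono2) auto
  obtain c where "c > 0" and c: "\<And>n. 0 < n \<Longrightarrow> \<exists>\<epsilon>>0. \<forall>b. b 0 \<le> M \<longrightarrow> 0 \<le> b n \<longrightarrow>
    (\<forall>j<n. b (Suc j) \<le> b j + \<epsilon> \<and> b (Suc j) \<le> C * (b j - b (Suc j) + \<epsilon>) powr \<beta> + \<epsilon>) \<longrightarrow>
    b n \<le> c * real n powr (- (\<beta> / (1 - \<beta>)))"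
    using perturbed_powr_recursion_decay[OF \<beta> \<open>0 < C\<close> \<open>M > 0\<close>] by blast
  have net: "\<exists>F. finite F \<and> F \<subseteq> S (s + real n * T) s ` B s \<and>
    S (s + real n * T) s ` B s \<subseteq> (\<Union>x\<in>F. cball x (c powr (1 / r) * real n powr p))"
    if n: "0 < n" for n s
  proof -
    obtain \<epsilon> where "\<epsilon> > 0" and \<epsilon>: "\<And>b. b 0 \<le> M \<Longrightarrow> 0 \<le> b n \<Longrightarrow>
      (\<forall>j<n. b (Suc j) \<le> b j + \<epsilon> \<and> b (Suc j) \<le> C * (b j - b (Suc j) + \<epsilon>) powr \<beta> + \<epsilon>) \<Longrightarrow>
      b n \<le> c * real n powr (- (\<beta> / (1 - \<beta>)))"
      using c[OF n] by blast
    define f where "f j = S (s + real j * T) s" for j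
    have f: "f j ` B s \<subseteq> B (s + real j * T)" for j
      unfolding f_def using \<open>0 < T\<close> by (intro image_subset) simp
    have f_Suc: "S (s + real j * T + T) (s + real j * T) (f j x) = f (Suc j) x" for j x
      unfolding f_def using S_comp[of s "s + real j * T" "s + real j * T + T" x] \<open>0 < T\<close>
      by (simp add: algebra_simps)
    define d where "d x y j = dist (f j x) (f j y) powr r" for x y j
    have "subseq_pairwise (B s) (\<lambda>x y. \<forall>j\<in>{..<n}. d x y (Suc j) \<le> d x y j + \<epsilon> \<and>
        d x y (Suc j) \<le> C * (d x y j - d x y (Suc j) + \<epsilon>) powr \<beta> + \<epsilon>)"
    proof (intro subseq_pairwise_ball)
      fix j
      show "subseq_pairwise (B s) (\<lambda>x y. d x y (Suc j) \<le> d x y j + \<epsilon> \<and>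
        d x y (Suc j) \<le> C * (d x y j - d x y (Suc j) + \<epsilon>) powr \<beta> + \<epsilon>)"
        using subseq_pairwise_vimage[OF step[OF \<open>\<epsilon> > 0\<close>] f[of j]] unfolding f_Suc d_def .
    qed simp
    then have "subseq_pairwise (B s)
      (\<lambda>x y. dist (f n x) (f n y) \<le> c powr (1 / r) * real n powr p)"
    proof (rule subseq_pairwise_mono)
      fix x y assume xy: "x \<in> B s" "y \<in> B s"
        and rec: "\<forall>j\<in>{..<n}. d x y (Suc j) \<le> d x y j + \<epsilon> \<and>
          d x y (Suc j) \<le> C * (d x y j - d x y (Suc j) + \<epsilon>) powr \<beta> + \<epsilon>"
      have "d x y 0 \<le> M" using M[OF xy] by (simp add: d_def f_def S_refl)
      then have "d x y n \<le> c * real n powr (- (\<beta> / (1 - \<beta>)))"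
        using rec by (intro \<epsilon>) (auto simp: d_def)
      then have "d x y n powr (1 / r) \<le> (c * real n powr (- (\<beta> / (1 - \<beta>)))) powr (1 / r)"
        using \<open>0 < r\<close> by (intro powr_mono2) (auto simp: d_def)
      also have "\<dots> = c powr (1 / r) * real n powr p"
        using \<open>c > 0\<close> by (simp only: p[symmetric] powr_mult powr_powr)
      finally show "dist (f n x) (f n y) \<le> c powr (1 / r) * real n powr p"
        using \<open>0 < r\<close> by (simp add: d_def powr_powr)
    qed
    then have "subseq_pairwise (f n ` B s) (\<lambda>x y. dist x y \<le> c powr (1 / r) * real n powr p)"
      by (rule subseq_pairwise_image)
    then show ?thesis
      unfolding f_def by (rule subseq_pairwise_dist_imp_finite_net)
  qed
  show ?thesis
    using net \<open>c > 0\<close> unfolding p_def by (intro exI[of _ "c powr (1 / r)"]) auto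
qed

end

section \<open>From finite nets to dissipativity and the attractor\<close>

lemma powr_rate:
  fixes p :: real
  assumes "0 < \<tau>" "0 < K" "\<tau> / K \<le> x" "p < 0"
  shows "x powr p \<le> K powr (- p) * \<tau> powr p"
proof -
  have "x powr p \<le> (\<tau> / K) powr p" using assms by (intro powr_mono2') auto
  also have "\<dots> = K powr (- p) * \<tau> powr p" by (simp add: powr_divide powr_minus field_simps)
  finally show ?thesis .
qed

context absorbed_process
begin

text \<open>The same n serves all \<sigma> >= \<tau> in \<open>eventually_absorbed\<close>, so a
  single net covers the whole tail union.\<close>

lemma kappa_dissipative_of_finite_nets:
  assumes "0 < T" "0 < c" "p < 0"
    and net: "\<And>n s. 0 < n \<Longrightarrow> \<exists>F. finite F \<and>
      S (s + real n * T) s ` B s \<subseteq> (\<Union>x\<in>F. cball x (c * real n powr p))"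
  shows "pullback_kappa_dissipative 1 (\<lambda>\<tau>. \<tau> powr p) S"
  unfolding pullback_kappa_dissipative_def
\<comment> \<open>A power function turns rescaling of time into a constant factor, so \<omega> = 1
  will do.\<close>
proof (rule exI[of _ 1], intro conjI allI impI)
  fix D :: "'a set" and t :: real assume "bounded D"
  obtain \<tau>\<^sub>0 where "1 \<le> \<tau>\<^sub>0" and \<tau>\<^sub>0: "\<And>\<tau>. \<tau>\<^sub>0 \<le> \<tau> \<Longrightarrow> \<exists>n>0. \<tau> / (2 * T) \<le> real n \<and>
      (\<forall>\<sigma>\<ge>\<tau>. S t (t - \<sigma>) ` D \<subseteq> S t (t - real n * T) ` B (t - real n * T))"
    using eventually_absorbed[OF \<open>bounded D\<close> \<open>0 < T\<close>] by blast
  \<comment> \<open>The factor 2 passes from radius to diameter; (2T)^(-p) comes from n >=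
    \<tau>/(2T).\<close>
  define C where "C = 2 * (c * (2 * T) powr (- p))"
  have "kuratowski (\<Union>\<sigma>\<in>{\<tau>..}. S t (t - \<sigma>) ` D) \<le> ennreal (C * (1 * \<tau>) powr p)"
    if \<tau>: "\<tau>\<^sub>0 \<le> \<tau>" for \<tau>
  proof -
    obtain n where n: "n > 0" "\<tau> / (2 * T) \<le> real n"
      "\<And>\<sigma>. \<tau> \<le> \<sigma> \<Longrightarrow> S t (t - \<sigma>) ` D \<subseteq> S t (t - real n * T) ` B (t - real n * T)"
      using \<tau>\<^sub>0[OF \<tau>] by blast
    obtain F where F: "finite F"
      "S t (t - real n * T) ` B (t - real n * T) \<subseteq> (\<Union>x\<in>F. cball x (c * real n powr p))"
      using net[OF n(1), of "t - real n * T"] by auto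
    have "kuratowski (\<Union>\<sigma>\<in>{\<tau>..}. S t (t - \<sigma>) ` D) \<le> ennreal (2 * (c * real n powr p))"
    proof (rule kuratowski_le[OF F(1)])
      show "(\<Union>\<sigma>\<in>{\<tau>..}. S t (t - \<sigma>) ` D) \<subseteq> (\<Union>x\<in>F. cball x (c * real n powr p))"
        by (intro UN_least subset_trans[OF n(3) F(2)]) simp
    qed (use n assms in auto)
    also have "2 * (c * real n powr p) \<le> C * (1 * \<tau>) powr p"
      using powr_rate[of \<tau> "2 * T" "real n" p] n(2) assms that \<open>1 \<le> \<tau>\<^sub>0\<close>
      by (simp add: C_def mult.assoc)
    finally show ?thesis using ennreal_leI by (simp add: order_trans)
  qed
  then show "\<exists>C\<ge>0. \<exists>\<tau>\<^sub>0\<ge>0. 1 \<le> 1 * \<tau>\<^sub>0 \<and> (\<forall>\<tau>\<ge>\<tau>\<^sub>0.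
      kuratowski (\<Union>\<sigma>\<in>{\<tau>..}. S t (t - \<sigma>) ` D) \<le> ennreal (C * (1 * \<tau>) powr p))"
    using \<open>1 \<le> \<tau>\<^sub>0\<close> \<open>0 < c\<close> by (intro exI[of _ C] exI[of _ \<tau>\<^sub>0] conjI) (auto simp: C_def)
qed simp

text \<open>
  On the lattice of times \<open>i T\<close> the attractor is the closure of the union of all finite nets,
  transported forward by the process. All but finitely many of the transported points lie in
  the image of \<open>B\<close> after \<open>N\<close> steps, so the closure is compact; including the transported points
  makes it positively invariant.
\<close>
lemma lattice_attractor:
  assumes "0 < T" "0 < c" "p < 0"
    and net: "\<And>n s. 0 < n \<Longrightarrow> \<exists>F. finite F \<and> F \<subseteq> S (s + real n * T) s ` B s \<and>
      S (s + real n * T) s ` B s \<subseteq> (\<Union>x\<in>F. cball x (c * real n powr p))"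
  shows "\<exists>M :: int \<Rightarrow> 'a set. \<forall>i. M i \<noteq> {} \<and> compact (M i) \<and> M i \<subseteq> B (of_int i * T) \<and>
    (\<forall>k\<ge>i. S (of_int k * T) (of_int i * T) ` M i \<subseteq> M k) \<and>
    (\<forall>n>0. \<forall>u\<in>S (of_int i * T) (of_int i * T - real n * T) ` B (of_int i * T - real n * T).
      \<exists>v\<in>M i. dist u v \<le> c * real n powr p)"
proof -
  define \<theta> where "\<theta> i = of_int i * T" for i :: int
  have \<theta>_mono: "\<theta> i \<le> \<theta> k" if "i \<le> k" for i k
    using that \<open>0 < T\<close> by (simp add: \<theta>_def)
  have \<theta>_diff: "\<theta> (i - int n) = \<theta> i - real n * T" for i n
    by (simp add: \<theta>_def algebra_simps)
  have "\<forall>n i. \<exists>F. 0 < n \<longrightarrow> finite F \<and> F \<subseteq> S (\<theta> i) (\<theta> (i - int n)) ` B (\<theta> (i - int n)) \<and>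
      S (\<theta> i) (\<theta> (i - int n)) ` B (\<theta> (i - int n)) \<subseteq> (\<Union>x\<in>F. cball x (c * real n powr p))"
  proof (intro allI)
    fix n i
    show "\<exists>F. 0 < n \<longrightarrow> finite F \<and> F \<subseteq> S (\<theta> i) (\<theta> (i - int n)) ` B (\<theta> (i - int n)) \<and>
      S (\<theta> i) (\<theta> (i - int n)) ` B (\<theta> (i - int n)) \<subseteq> (\<Union>x\<in>F. cball x (c * real n powr p))"
      using net[of n "\<theta> (i - int n)"] by (auto simp: \<theta>_diff)
  qed
  then obtain F where F: "\<And>n i. 0 < n \<Longrightarrow> finite (F n i)"
    "\<And>n i. 0 < n \<Longrightarrow> F n i \<subseteq> S (\<theta> i) (\<theta> (i - int n)) ` B (\<theta> (i - int n))"
    "\<And>n i. 0 < n \<Longrightarrow> S (\<theta> i) (\<theta> (i - int n)) ` B (\<theta> (i - int n))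
      \<subseteq> (\<Union>x\<in>F n i. cball x (c * real n powr p))"
    by metis
  \<comment> \<open>Here n is the index of a net and j the number of steps it is carried forward; j
    = 0 keeps the nets at time i themselves.\<close>
  define E where "E i = (\<Union>j. \<Union>n\<in>{1..}. S (\<theta> i) (\<theta> (i - int j)) ` F n (i - int j))" for i
  have F_subset_E: "F n i \<subseteq> E i" if "0 < n" for n i
  proof
    fix x assume "x \<in> F n i"
    then have "x \<in> S (\<theta> i) (\<theta> (i - int 0)) ` F n (i - int 0)" by (simp add: S_refl)
    then show "x \<in> E i" unfolding E_def using that by (intro UN_I[of 0] UN_I[of n]) auto
  qed
  have transported: "S (\<theta> i) (\<theta> (i - int j)) ` F n (i - int j)
      \<subseteq> S (\<theta> i) (\<theta> (i - int N)) ` B (\<theta> (i - int N))"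
    if n: "0 < n" and N: "N \<le> j + n" for i j n N
  proof -
    have "S (\<theta> i) (\<theta> (i - int j)) ` F n (i - int j)
        \<subseteq> S (\<theta> i) (\<theta> (i - int (j + n))) ` B (\<theta> (i - int (j + n)))"
    proof (rule image_subsetI)
      fix x assume "x \<in> F n (i - int j)"
      then obtain y where "y \<in> B (\<theta> (i - int (j + n)))"
        "x = S (\<theta> (i - int j)) (\<theta> (i - int (j + n))) y"
        using F(2)[OF n, of "i - int j"] by (auto simp: algebra_simps)
      then show "S (\<theta> i) (\<theta> (i - int j)) x
          \<in> S (\<theta> i) (\<theta> (i - int (j + n))) ` B (\<theta> (i - int (j + n)))"
        using \<theta>_mono by (simp add: S_comp)
    qed
    also have "\<dots> \<subseteq> S (\<theta> i) (\<theta> (i - int N)) ` B (\<theta> (i - int N))"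
      using N \<theta>_mono by (intro image_antimono) auto
    finally show ?thesis .
  qed
  have E_B: "E i \<subseteq> B (\<theta> i)" for i
  proof -
    have "S (\<theta> i) (\<theta> (i - int j)) ` F n (i - int j) \<subseteq> B (\<theta> i)" if "n \<in> {1..}" for j n
      using transported[of n 0 j i] that by (simp add: S_refl)
    then show ?thesis unfolding E_def by (intro UN_least)
  qed
  then have closure_B: "closure (E i) \<subseteq> B (\<theta> i)" for i
    using closed_B by (intro closure_minimal) (auto simp: closed_family_def)
  have "E i \<noteq> {}" for i
  proof -
    obtain x where "x \<in> B (\<theta> (i - int 1))" using nonempty_B unfolding set_family_def by blast
    then have "F 1 i \<noteq> {}" using F(3)[of 1 i] by auto
    then show ?thesis using F_subset_E[of 1 i] by auto
  qed
  moreover have "S (\<theta> k) (\<theta> i) ` closure (E i) \<subseteq> closure (E k)" if "i \<le> k" for i k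
  proof (rule image_closure_subset)
    show "continuous_on (closure (E i)) (S (\<theta> k) (\<theta> i))"
      using that \<theta>_mono by (intro continuous_on_S)
    have "S (\<theta> k) (\<theta> i) x \<in> E k" if "x \<in> E i" for x
    proof -
      obtain j n y where y: "n \<in> {1..}" "y \<in> F n (i - int j)" "x = S (\<theta> i) (\<theta> (i - int j)) y"
        using \<open>x \<in> E i\<close> unfolding E_def by auto
      \<comment> \<open>Moving on from i to k merely increases the transport count j by k - i, so
        the point is again one of those collected in \<open>E k\<close>.\<close>
      have shift: "i - int j = k - int (j + nat (k - i))" using \<open>i \<le> k\<close> by simp
      have "S (\<theta> k) (\<theta> i) x = S (\<theta> k) (\<theta> (i - int j)) y"
        using \<open>i \<le> k\<close> \<theta>_mono unfolding y(3) by (intro S_comp) auto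
      then show ?thesis
        using y(1,2) unfolding E_def shift by blast
    qed
    then show "S (\<theta> k) (\<theta> i) ` E i \<subseteq> closure (E k)" using closure_subset by blast
  qed simp
  moreover have "compact (closure (E i))" for i
    unfolding compact_eq_totally_bounded
  proof (intro conjI allI impI)
    show "complete (closure (E i))" by (simp add: complete_eq_closed)
    fix e :: real assume "0 < e"
    have "((\<lambda>n. c * real n powr p) \<longlongrightarrow> c * 0) sequentially"
      using \<open>p < 0\<close> by (intro tendsto_intros tendsto_neg_powr filterlim_real_sequentially)
    then have "eventually (\<lambda>n. c * real n powr p < e) sequentially"
      using \<open>0 < e\<close> by (intro order_tendstoD) auto
    then have "eventually (\<lambda>n. c * real n powr p < e \<and> 0 < n) sequentially"
      using eventually_gt_at_top[of 0] by (rule eventually_conj)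
    then obtain N where N: "c * real N powr p < e" "0 < N"
      using eventually_happens'[OF sequentially_bot] by blast
    \<comment> \<open>Nets with j + n >= N are covered through \<open>F N i\<close>; the pairs with
      j + n < N lie in the finite square j, n < N.\<close>
    define G where "G = F N i \<union> (\<Union>j\<in>{..<N}. \<Union>n\<in>{1..<N}. S (\<theta> i) (\<theta> (i - int j)) ` F n (i - int j))"
    have "finite G" unfolding G_def using F(1) N(2) by auto
    have "0 \<le> c * real N powr p" using \<open>0 < c\<close> by simp
    have "S (\<theta> i) (\<theta> (i - int j)) ` F n (i - int j) \<subseteq> (\<Union>x\<in>G. cball x (c * real N powr p))"
      if n: "n \<in> {1..}" for j n
    proof (cases "N \<le> j + n")
      case True
      then have "S (\<theta> i) (\<theta> (i - int j)) ` F n (i - int j) \<subseteq> (\<Union>x\<in>F N i. cball x (c * real N powr p))"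
        using transported[of n N j i] F(3)[OF N(2), of i] n by auto
      then show ?thesis unfolding G_def by blast
    next
      case False
      then have "S (\<theta> i) (\<theta> (i - int j)) ` F n (i - int j) \<subseteq> G"
        unfolding G_def using n by (intro subsetI UnI2 UN_I[of j] UN_I[of n]) auto
      moreover have "G \<subseteq> (\<Union>x\<in>G. cball x (c * real N powr p))"
        using \<open>0 \<le> c * real N powr p\<close> by (intro subsetI UN_I) auto
      ultimately show ?thesis by (rule subset_trans)
    qed
    \<comment> \<open>Closed balls of radius below e are used first: their finite union is closed
      and hence contains the closure.\<close>
    then have "E i \<subseteq> (\<Union>x\<in>G. cball x (c * real N powr p))"
      unfolding E_def by (intro UN_least)
    then have "closure (E i) \<subseteq> (\<Union>x\<in>G. cball x (c * real N powr p))"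
      using \<open>finite G\<close> by (intro closure_minimal closed_UN) auto
    also have "\<dots> \<subseteq> (\<Union>x\<in>G. ball x e)" using N(1) by (intro UN_mono) auto
    finally show "\<exists>G. finite G \<and> closure (E i) \<subseteq> (\<Union>x\<in>G. ball x e)"
      using \<open>finite G\<close> by blast
  qed
  moreover have "\<exists>v\<in>closure (E i). dist u v \<le> c * real n powr p"
    if n: "0 < n" and u: "u \<in> S (\<theta> i) (\<theta> i - real n * T) ` B (\<theta> i - real n * T)" for i n u
  proof -
    obtain v where "v \<in> F n i" "dist u v \<le> c * real n powr p"
      using subsetD[OF F(3)[OF n, of i], unfolded \<theta>_diff, OF u] by (auto simp: dist_commute)
    then show ?thesis using F_subset_E[OF n, of i] closure_subset by blast
  qed
  ultimately show ?thesis
    using closure_B unfolding \<theta>_def by (intro exI[of _ "\<lambda>i. closure (E i)"]) auto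
qed

text \<open>Between lattice times the rate is carried from \<theta> t to t by a single Lipschitz
  map, whose constant goes into C(D, t).\<close>

lemma generalized_attractor_of_finite_nets:
  assumes "0 < T" "0 < c" "p < 0"
    and net: "\<And>n s. 0 < n \<Longrightarrow> \<exists>F. finite F \<and> F \<subseteq> S (s + real n * T) s ` B s \<and>
      S (s + real n * T) s ` B s \<subseteq> (\<Union>x\<in>F. cball x (c * real n powr p))"
    and lipschitz: "\<And>s t. s \<le> t \<Longrightarrow>
      \<exists>L>0. \<forall>x\<in>B s. \<forall>y\<in>B s. dist (S t s x) (S t s y) \<le> L * dist x y"
  shows "\<exists>M. uniformly_bounded M \<and> generalized_pullback_attractor 1 (\<lambda>\<tau>. \<tau> powr p) S M"
proof -
  obtain M0 :: "int \<Rightarrow> 'a set" where M0: "\<And>i. M0 i \<noteq> {}" "\<And>i. compact (M0 i)"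
    "\<And>i. M0 i \<subseteq> B (of_int i * T)"
    "\<And>i k. i \<le> k \<Longrightarrow> S (of_int k * T) (of_int i * T) ` M0 i \<subseteq> M0 k"
    "\<And>i n u. 0 < n \<Longrightarrow>
      u \<in> S (of_int i * T) (of_int i * T - real n * T) ` B (of_int i * T - real n * T) \<Longrightarrow>
      \<exists>v\<in>M0 i. dist u v \<le> c * real n powr p"
    using lattice_attractor[OF assms(1-4)] by metis
  define idx where "idx t = \<lfloor>t / T\<rfloor>" for t
  define \<theta> where "\<theta> t = of_int (idx t) * T" for t
  have \<theta>: "\<theta> t \<le> t" "t < \<theta> t + T" for t
    using floor_divide_lower[OF \<open>0 < T\<close>, of t] floor_divide_upper[OF \<open>0 < T\<close>, of t]
    unfolding \<theta>_def idx_def by (auto simp: algebra_simps)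
  have mono: "idx s \<le> idx t" "\<theta> s \<le> \<theta> t" if "s \<le> t" for s t
  proof -
    show "idx s \<le> idx t" unfolding idx_def
      using that \<open>0 < T\<close> by (intro floor_mono divide_right_mono) auto
    then show "\<theta> s \<le> \<theta> t" unfolding \<theta>_def using \<open>0 < T\<close> by simp
  qed
  define M where "M t = S t (\<theta> t) ` M0 (idx t)" for t
  have M_B: "M t \<subseteq> B t" for t
    unfolding M_def using M0(3)[of "idx t"] image_subset[OF \<theta>(1)[of t]]
    by (auto simp: \<theta>_def)
  have "uniformly_bounded M"
    using bounded_B M_B unfolding uniformly_bounded_def
    by (meson UN_mono bounded_subset subset_UNIV)
  moreover have "set_family M" using M0(1) by (simp add: set_family_def M_def)
  moreover have "compact_family M"
    unfolding compact_family_def M_def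
    using M0(2) \<theta>(1) by (intro allI compact_continuous_image continuous_on_S)
  moreover have "positively_invariant S M"
    unfolding positively_invariant_def M_def
  proof (intro allI impI image_subsetI)
    fix t s x assume "s \<le> t" and x: "x \<in> S s (\<theta> s) ` M0 (idx s)"
    then obtain y where y: "y \<in> M0 (idx s)" "x = S s (\<theta> s) y" by blast
    \<comment> \<open>Both sides equal \<open>S t (\<theta> s) y\<close>. The path is factored
      through \<theta> t instead of s, which may lie on either side of \<theta> t.\<close>
    have "S t s x = S t (\<theta> t) (S (\<theta> t) (\<theta> s) y)"
      using \<open>s \<le> t\<close> \<theta>(1) mono(2)[OF \<open>s \<le> t\<close>] unfolding y(2) by (simp add: S_comp)
    moreover have "S (\<theta> t) (\<theta> s) y \<in> M0 (idx t)"
      using M0(4)[OF mono(1)[OF \<open>s \<le> t\<close>]] y(1) unfolding \<theta>_def by blast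
    ultimately show "S t s x \<in> S t (\<theta> t) ` M0 (idx t)" by blast
  qed
  moreover have "\<exists>C\<ge>0. \<exists>\<tau>\<^sub>0\<ge>0. 1 \<le> 1 * \<tau>\<^sub>0 \<and>
      (\<forall>\<tau>\<ge>\<tau>\<^sub>0. hausdorff_semidist (S t (t - \<tau>) ` D) (M t) \<le> ennreal (C * (1 * \<tau>) powr p))"
    if "bounded D" for D t
  proof -
    obtain \<tau>\<^sub>1 where "1 \<le> \<tau>\<^sub>1" and \<tau>\<^sub>1: "\<And>\<tau>. \<tau>\<^sub>1 \<le> \<tau> \<Longrightarrow> \<exists>n>0. \<tau> / (2 * T) \<le> real n \<and>
        (\<forall>\<sigma>\<ge>\<tau>. S (\<theta> t) (\<theta> t - \<sigma>) ` D \<subseteq> S (\<theta> t) (\<theta> t - real n * T) ` B (\<theta> t - real n * T))"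
      using eventually_absorbed[OF \<open>bounded D\<close> \<open>0 < T\<close>] by blast
    obtain L where "0 < L" and L: "\<And>x y. x \<in> B (\<theta> t) \<Longrightarrow> y \<in> B (\<theta> t) \<Longrightarrow>
        dist (S t (\<theta> t) x) (S t (\<theta> t) y) \<le> L * dist x y"
      using lipschitz[OF \<theta>(1)] by meson
    \<comment> \<open>The number 4T combines n >= \<sigma>/(2T) with \<sigma> >= \<tau>/2, where
      \<sigma> is the time elapsed up to \<theta> t.\<close>
    define C where "C = L * c * (4 * T) powr (- p)"
    have "hausdorff_semidist (S t (t - \<tau>) ` D) (M t) \<le> ennreal (C * (1 * \<tau>) powr p)"
      if \<tau>: "\<tau>\<^sub>1 + 2 * T \<le> \<tau>" for \<tau>
    proof (rule hausdorff_semidist_le)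
      fix u assume "u \<in> S t (t - \<tau>) ` D"
      then obtain x where x: "x \<in> D" "u = S t (t - \<tau>) x" by blast
      define \<sigma> where "\<sigma> = \<tau> - (t - \<theta> t)"
      have \<sigma>: "\<tau>\<^sub>1 \<le> \<sigma>" "\<tau> / 2 \<le> \<sigma>" "\<theta> t - \<sigma> = t - \<tau>"
        using \<tau> \<theta>[of t] \<open>1 \<le> \<tau>\<^sub>1\<close> \<open>0 < T\<close> by (auto simp: \<sigma>_def)
      obtain n where n: "0 < n" "\<sigma> / (2 * T) \<le> real n"
        "S (\<theta> t) (\<theta> t - \<sigma>) ` D \<subseteq> S (\<theta> t) (\<theta> t - real n * T) ` B (\<theta> t - real n * T)"
        using \<tau>\<^sub>1[OF \<sigma>(1)] by blast
      define w where "w = S (\<theta> t) (\<theta> t - \<sigma>) x"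
      have w: "w \<in> S (\<theta> t) (\<theta> t - real n * T) ` B (\<theta> t - real n * T)"
        using n(3) x(1) unfolding w_def by blast
      then have "w \<in> B (\<theta> t)"
        using image_subset[of "\<theta> t - real n * T" "\<theta> t"] \<open>0 < T\<close> by auto
      obtain v where v: "v \<in> M0 (idx t)" "dist w v \<le> c * real n powr p"
        using M0(5)[OF n(1) w[unfolded \<theta>_def]] by blast
      have "u = S t (\<theta> t) w"
        unfolding w_def x(2) \<sigma>(3)[symmetric] using \<theta>(1) \<sigma> \<tau> \<open>1 \<le> \<tau>\<^sub>1\<close>
        by (intro S_comp[symmetric]) auto
      then have "dist u (S t (\<theta> t) v) \<le> L * dist w v"
        using L[OF \<open>w \<in> B (\<theta> t)\<close>, of v] v(1) M0(3)[of "idx t"] by (auto simp: \<theta>_def)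
      also have "\<dots> \<le> L * (c * real n powr p)"
        using v(2) \<open>0 < L\<close> by (intro mult_left_mono) auto
      also have "real n powr p \<le> (4 * T) powr (- p) * \<tau> powr p"
      proof (rule powr_rate)
        have "\<tau> / (4 * T) \<le> \<sigma> / (2 * T)" using \<sigma>(2) \<open>0 < T\<close> by (simp add: field_simps)
        then show "\<tau> / (4 * T) \<le> real n" using n(2) by linarith
      qed (use \<tau> \<open>1 \<le> \<tau>\<^sub>1\<close> \<open>0 < T\<close> \<open>p < 0\<close> in auto)
      then have "L * (c * real n powr p) \<le> C * (1 * \<tau>) powr p"
        unfolding C_def using \<open>0 < L\<close> \<open>0 < c\<close> by (simp add: mult.assoc)
      finally show "\<exists>v\<in>M t. dist u v \<le> C * (1 * \<tau>) powr p"
        unfolding M_def using v(1) by blast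
    qed
    then show ?thesis
      using \<open>0 < L\<close> \<open>0 < c\<close> \<open>1 \<le> \<tau>\<^sub>1\<close> \<open>0 < T\<close>
      by (intro exI[of _ C] exI[of _ "\<tau>\<^sub>1 + 2 * T"] conjI) (auto simp: C_def)
  qed
  then have "\<exists>\<omega>>0. \<forall>D t. bounded D \<longrightarrow> (\<exists>C\<ge>0. \<exists>\<tau>\<^sub>0\<ge>0. 1 \<le> \<omega> * \<tau>\<^sub>0 \<and>
      (\<forall>\<tau>\<ge>\<tau>\<^sub>0. hausdorff_semidist (S t (t - \<tau>) ` D) (M t) \<le> ennreal (C * (\<omega> * \<tau>) powr p)))"
    by (intro exI[of _ "1 :: real"]) simp
  ultimately show ?thesis
    unfolding generalized_pullback_attractor_def by blast
qed

end

section \<open>From quasi-stability to dissipativity and the attractor\<close>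

theorem theorem2p7:
  fixes S :: "real \<Rightarrow> real \<Rightarrow> 'a \<Rightarrow> 'a :: complete_space"
    and B :: "real \<Rightarrow> 'a set"
    and \<gamma> \<beta> r T C :: real
  assumes process: "evolution_process S"
    and B: "set_family B" "closed_family B" "uniformly_bounded B"
      "positively_invariant S B" "uniformly_pullback_absorbing S B"
    and "\<gamma> > 0"
    and lipschitz: "\<forall>s. \<forall>\<tau>\<in>{0..\<gamma>}. \<exists>L>0. \<forall>x\<in>B s. \<forall>y\<in>B s.
      dist (S (s + \<tau>) s x) (S (s + \<tau>) s y) \<le> L * dist x y"
    and "0 < \<beta>" "\<beta> < 1" "r > 0" "T > 0" "C > 0"
    and quasi_stable: "\<forall>t. \<exists>(m :: nat) (g1 :: (nat \<Rightarrow> real) \<Rightarrow> real) (g2 :: (nat \<Rightarrow> real) \<Rightarrow> real)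
        (\<psi>1 :: 'a \<Rightarrow> 'a \<Rightarrow> real) (\<psi>2 :: 'a \<Rightarrow> 'a \<Rightarrow> real) (\<rho> :: nat \<Rightarrow> 'a \<Rightarrow> 'a \<Rightarrow> real).
      m > 0 \<and>
      (\<forall>u\<in>orthant m. 0 \<le> g1 u \<and> 0 \<le> g2 u) \<and>
      (\<forall>x y. 0 \<le> \<psi>1 x y \<and> 0 \<le> \<psi>2 x y) \<and>
      (\<forall>i<m. pseudometric (\<rho> i)) \<and>
      (\<forall>g\<in>{g1, g2}. nondecreasing_in_each m g \<and> g (\<lambda>_. 0) = 0 \<and>
        continuous (at (\<lambda>_. 0) within orthant m) g) \<and>
      (\<forall>n :: nat. \<forall>i<m. precompact_on (\<rho> i) (B (t - real n * T))) \<and>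
      (\<forall>n :: nat. \<psi>1 \<in> contr (B (t - real n * T)) \<and> \<psi>2 \<in> contr (B (t - real n * T))) \<and>
      (\<forall>n :: nat. \<forall>x\<in>B (t - real n * T). \<forall>y\<in>B (t - real n * T).
        let Sn = S (t - (real n - 1) * T) (t - real n * T) in
          dist (Sn x) (Sn y) powr r \<le> dist x y powr r + g1 (pseudometric_vec m \<rho> x y) + \<psi>1 x y \<and>
          dist (Sn x) (Sn y) powr r \<le>
            C * (dist x y powr r - dist (Sn x) (Sn y) powr r + g1 (pseudometric_vec m \<rho> x y) + \<psi>1 x y) powr \<beta>
            + g2 (pseudometric_vec m \<rho> x y) + \<psi>2 x y)"
  defines "\<phi> \<equiv> \<lambda>s. s powr (\<beta> / (r * (\<beta> - 1)))"
  shows "\<exists>k>0. decay_function k \<phi> \<and>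
    pullback_kappa_dissipative k \<phi> S \<and>
    (\<exists>M. uniformly_bounded M \<and> generalized_pullback_attractor k \<phi> S M)"
proof -
  interpret absorbed_process S B
    using process B by unfold_locales
  define p where "p = \<beta> / (r * (\<beta> - 1))"
  have "p < 0"
    using \<open>0 < \<beta>\<close> \<open>\<beta> < 1\<close> \<open>r > 0\<close> by (simp add: p_def divide_pos_neg mult_pos_neg)
  have step: "subseq_pairwise (B s) (\<lambda>x y.
      dist (S (s + T) s x) (S (s + T) s y) powr r \<le> dist x y powr r + \<epsilon> \<and>
      dist (S (s + T) s x) (S (s + T) s y) powr r \<le>
        C * (dist x y powr r - dist (S (s + T) s x) (S (s + T) s y) powr r + \<epsilon>) powr \<beta> + \<epsilon>)"
    if "0 < \<epsilon>" for s \<epsilon>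
  proof -
    \<comment> \<open>With t = s and n = 0 the map S_n is S(s + T, s), so the hypothesis describes
      the step that starts at s.\<close>
    obtain m :: nat and g1 g2 :: "(nat \<Rightarrow> real) \<Rightarrow> real" and \<psi>1 \<psi>2 :: "'a \<Rightarrow> 'a \<Rightarrow> real"
      and \<rho> :: "nat \<Rightarrow> 'a \<Rightarrow> 'a \<Rightarrow> real" where
      \<rho>: "\<forall>i<m. pseudometric (\<rho> i)"
      and g: "\<forall>g\<in>{g1, g2}. nondecreasing_in_each m g \<and> g (\<lambda>_. 0) = 0 \<and>
        continuous (at (\<lambda>_. 0) within orthant m) g"
      and precompact: "\<forall>n :: nat. \<forall>i<m. precompact_on (\<rho> i) (B (s - real n * T))"
      and contr: "\<forall>n :: nat. \<psi>1 \<in> contr (B (s - real n * T)) \<and> \<psi>2 \<in> contr (B (s - real n * T))"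
      and est: "\<forall>n :: nat. \<forall>x\<in>B (s - real n * T). \<forall>y\<in>B (s - real n * T).
        let Sn = S (s - (real n - 1) * T) (s - real n * T) in
          dist (Sn x) (Sn y) powr r \<le> dist x y powr r + g1 (pseudometric_vec m \<rho> x y) + \<psi>1 x y \<and>
          dist (Sn x) (Sn y) powr r \<le>
            C * (dist x y powr r - dist (Sn x) (Sn y) powr r + g1 (pseudometric_vec m \<rho> x y) + \<psi>1 x y) powr \<beta>
            + g2 (pseudometric_vec m \<rho> x y) + \<psi>2 x y"
      using quasi_stable[THEN spec, of s] by (elim exE conjE) (rule that; assumption)
    \<comment> \<open>Each inequality has one g term and one \<psi> term, hence the halves.\<close>
    have "\<epsilon> / 2 > 0" using \<open>0 < \<epsilon>\<close> by simp
    have small_g: "subseq_pairwise (B s) (\<lambda>x y. g (pseudometric_vec m \<rho> x y) < \<epsilon> / 2)"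
      if "g \<in> {g1, g2}" for g
    proof -
      have "nondecreasing_in_each m g" "g (\<lambda>_. 0) = 0"
        "continuous (at (\<lambda>_. 0) within orthant m) g"
        using bspec[OF g that] by simp_all
      moreover have "precompact_on (\<rho> i) (B s)" if "i < m" for i
        using precompact[rule_format, OF that, of 0] by simp
      ultimately show ?thesis
        using \<rho> \<open>\<epsilon> / 2 > 0\<close> by (intro subseq_pairwise_pseudometric_vec) simp_all
    qed
    have small_\<psi>: "subseq_pairwise (B s) (\<lambda>x y. \<psi> x y < \<epsilon> / 2)" if "\<psi> \<in> {\<psi>1, \<psi>2}" for \<psi>
      using contr[THEN spec, of 0] that \<open>\<epsilon> / 2 > 0\<close> by (intro subseq_pairwise_contr) auto
    have "subseq_pairwise (B s) (\<lambda>x y.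
        (g1 (pseudometric_vec m \<rho> x y) < \<epsilon> / 2 \<and> g2 (pseudometric_vec m \<rho> x y) < \<epsilon> / 2) \<and>
        (\<psi>1 x y < \<epsilon> / 2 \<and> \<psi>2 x y < \<epsilon> / 2))"
      by (intro subseq_pairwise_conj small_g small_\<psi>) auto
    then show ?thesis
    proof (rule subseq_pairwise_mono)
      fix x y assume xy: "x \<in> B s" "y \<in> B s"
        and small: "(g1 (pseudometric_vec m \<rho> x y) < \<epsilon> / 2 \<and> g2 (pseudometric_vec m \<rho> x y) < \<epsilon> / 2) \<and>
          (\<psi>1 x y < \<epsilon> / 2 \<and> \<psi>2 x y < \<epsilon> / 2)"
      define a where "a = dist x y powr r"
      define b where "b = dist (S (s + T) s x) (S (s + T) s y) powr r"
      have b: "b \<le> a + g1 (pseudometric_vec m \<rho> x y) + \<psi>1 x y"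
        "b \<le> C * (a - b + g1 (pseudometric_vec m \<rho> x y) + \<psi>1 x y) powr \<beta>
          + g2 (pseudometric_vec m \<rho> x y) + \<psi>2 x y"
        using est[rule_format, of x 0 y] xy by (simp_all add: Let_def a_def b_def)
      \<comment> \<open>The first inequality makes the base nonnegative, so the power is monotone
        there.\<close>
      have "(a - b + g1 (pseudometric_vec m \<rho> x y) + \<psi>1 x y) powr \<beta> \<le> (a - b + \<epsilon>) powr \<beta>"
        using b(1) small \<open>0 < \<beta>\<close> by (intro powr_mono2) auto
      then have "C * (a - b + g1 (pseudometric_vec m \<rho> x y) + \<psi>1 x y) powr \<beta>
          \<le> C * (a - b + \<epsilon>) powr \<beta>"
        using \<open>C > 0\<close> by (intro mult_left_mono) auto
      then have "b \<le> a + \<epsilon> \<and> b \<le> C * (a - b + \<epsilon>) powr \<beta> + \<epsilon>"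
        using b small by linarith
      then show "dist (S (s + T) s x) (S (s + T) s y) powr r \<le> dist x y powr r + \<epsilon> \<and>
        dist (S (s + T) s x) (S (s + T) s y) powr r \<le>
          C * (dist x y powr r - dist (S (s + T) s x) (S (s + T) s y) powr r + \<epsilon>) powr \<beta> + \<epsilon>"
        unfolding a_def b_def .
    qed
  qed
  have "\<exists>c>0. \<forall>n>0. \<forall>s. \<exists>F. finite F \<and> F \<subseteq> S (s + real n * T) s ` B s \<and>
      S (s + real n * T) s ` B s \<subseteq> (\<Union>x\<in>F. cball x (c * real n powr p))"
    unfolding p_def using step
    by (rule finite_net_of_iterated_quasi_stability
        [OF \<open>0 < \<beta>\<close> \<open>\<beta> < 1\<close> \<open>r > 0\<close> \<open>T > 0\<close> \<open>C > 0\<close>])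
  then obtain c where "c > 0" and
    nets: "\<forall>n>0. \<forall>s. \<exists>F. finite F \<and> F \<subseteq> S (s + real n * T) s ` B s \<and>
      S (s + real n * T) s ` B s \<subseteq> (\<Union>x\<in>F. cball x (c * real n powr p))"
    by (elim exE conjE)
  note net = nets[rule_format]
  have "pullback_kappa_dissipative 1 \<phi> S"
    unfolding \<phi>_def p_def[symmetric]
  proof (rule kappa_dissipative_of_finite_nets[OF \<open>T > 0\<close> \<open>c > 0\<close> \<open>p < 0\<close>])
    show "\<exists>F. finite F \<and>
        S (s + real n * T) s ` B s \<subseteq> (\<Union>x\<in>F. cball x (c * real n powr p))" if "0 < n" for n s
      using net[OF that, of s] by (elim exE conjE) (rule exI, rule conjI)
  qed
  moreover have "\<exists>M. uniformly_bounded M \<and> generalized_pullback_attractor 1 \<phi> S M"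
    unfolding \<phi>_def p_def[symmetric]
    by (rule generalized_attractor_of_finite_nets[OF \<open>T > 0\<close> \<open>c > 0\<close> \<open>p < 0\<close> net
          lipschitz_extend[OF \<open>\<gamma> > 0\<close> lipschitz]])
  moreover have "decay_function 1 \<phi>"
    unfolding \<phi>_def p_def[symmetric] using \<open>p < 0\<close> by (rule decay_function_powr)
  ultimately show ?thesis by (intro exI[of _ 1]) auto
qed

end
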